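(* Let $L_{\mathrm{copy}}=\{u\$u\#v\$v \mid u,v\in\{a,b\}^*\}$, a language over the four-letter alphabet $\{a,b,\$,\#\}$. Every checking stack automaton (CSA) $M$ accepting the language $L_{\mathrm{copy}}$ is ${\rm s}$-unlimited.
   Context: **Stack automata.** A one-way nondeterministic stack automaton (SA) is a 6-tuple $M=(Q,\Sigma,\Gamma,\delta,q_0,F)$: $Q$ is a finite set of states; $\Sigma,\Gamma$ are the (finite) input and stack alphabets; $\Gamma$ contains two special symbols $\triangleright$ (bottom marker) and $\triangleleft$ (top marker), and $\Gamma_0=\Gamma\setminus\{\triangleright,\triangleleft\}$; $q_0\in Q$ is the initial state; $F\subseteq Q$ is the set of final states; $\delta$ is a nondeterministic transition function from $Q\times(\Sigma\cup\{\lambda\})\times\Gamma$ into subsets of $Q\times\{\mathtt{stay},\mathtt{push}(x),\mathtt{pop},-1,0,+1 \mid x\in\Gamma_0\}$ ($\lambda$ is the empty word). Write $(q,a,y)\to(p,\iota)$ for $(p,\iota)\in\delta(q,a,y)$. A configuration is a triple $c=(q,w,\gamma)$ with $q\in Q$ the current state, $w\in\Sigma^*$ the remaining input, and $\gamma\in \triangleright\Gamma_0^*\uparrow\Gamma_0^*\triangleleft$ or $\gamma\in\triangleright\Gamma_0^*\triangleleft\uparrow$, where $\uparrow\notin\Gamma$ marks the stack head, which scans the symbol directly preceding it. The stack size of $c$ is $\|c\|_\Gamma=|\gamma|-3$ (number of symbols of $\Gamma_0$ on the stack). Write relation $\vdash_w$: if $(q,a,x)\to(p,\iota)$ with $x\in\Gamma_0\cup\{\triangleright\}$,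 $a\in\Sigma\cup\{\lambda\}$, then for $u\in\Sigma^*$ and $\gamma x\triangleleft\in\triangleright\Gamma_0^*\triangleleft$: $(q,au,\gamma x\uparrow\triangleleft)\vdash_w(p,u,\gamma x\uparrow\triangleleft)$ if $\iota=\mathtt{stay}$; $(q,au,\gamma x\uparrow\triangleleft)\vdash_w(p,u,\gamma xy\uparrow\triangleleft)$ if $\iota=\mathtt{push}(y)$; $(q,au,\gamma x\uparrow\triangleleft)\vdash_w(p,u,\gamma\uparrow\triangleleft)$ if $\iota=\mathtt{pop}$ and $x\ne\triangleright$. (These moves are undefined if the head is not at the topmost stack symbol.) Read relation $\vdash_r$: if $(q,a,x)\to(p,\iota)$ with $x\in\Gamma$, then for $u\in\Sigma^*$ and $\gamma_1x\gamma_2\in\triangleright\Gamma_0^*\triangleleft$: $(q,au,\gamma_1x\uparrow\gamma_2)\vdash_r(p,u,\gamma_1\uparrow x\gamma_2)$ if $\iota=-1$ and $x\neq\triangleright$; $(q,au,\gamma_1x\uparrow\gamma_2)\vdash_r(p,u,\gamma_1x\uparrow\gamma_2)$ if $\iota=0$; $(q,au,\gamma_1x\uparrow\gamma_2)\vdash_r(p,u,\gamma_1xy\uparrow\gamma_2')$ if $\iota=+1$ and $\gamma_2=y\gamma_2'$, $y\in\Gamma$. Let $\vdash=\vdash_w\cup\vdash_r$. A partial computation on $u\in\Sigma^*$ is a finite sequence of configurations $c_0\vdash\cdots\vdash c_m$ with $c_0=(q_0,u,\triangleright\uparrow\triangleleft)$. It is a computation if the remaining input in $c_m$ is $\lambda$,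 and an accepting computation if moreover the state of $c_m$ is in $F$. Its stack size is $\|\mathcal C\|_\Gamma=\max_j\|c_j\|_\Gamma$. The accepted language $L(M)$ is the set of words on which $M$ has an accepting computation. An SA has partitioned states if $Q$ is a disjoint union $Q_w\cup Q_r$ (write states and read states), $F\subseteq Q_r$, all transitions from states in $Q_w$ have $\iota\in\{\mathtt{stay},\mathtt{push}(x),\mathtt{pop}\}$ and all transitions from states in $Q_r$ have $\iota\in\{-1,0,+1\}$. An SA is non-erasing (NESA) if it has no $\mathtt{pop}$ transitions. A checking stack automaton (CSA) is a NESA with partitioned states and with no transitions from a read state to a write state. **Strong space measure.** For $u\in\Sigma^*$, $\sigma^{\rm s}_M(u)$ is the maximum of $\|\mathcal C\|_\Gamma$ over all partial computations $\mathcal C$ of $M$ on $u$ if it exists, and $\infty$ if $M$ has partial computations on $u$ of arbitrarily large stack size. $M$ is ${\rm s}$-unlimited if $\sigma^{\rm s}_M(u)=\infty$ for some word $u\in\Sigma^*$. *)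

theory Defs
  imports Main "HOL-Library.Extended_Nat"
begin

text \<open>\<open>Left\<close>, \<open>Still\<close>, \<open>Right\<close> are the head moves $-1$, $0$, $+1$; \<open>Left\<close> goes towards
  the bottom marker.\<close>

datatype 'g instr = Stay | Push 'g | Pop | Left | Still | Right

record ('q, 'a, 'g) sa =
  States :: "'q set"
  Input :: "'a set"
  Stack :: "'g set"
  Bottom :: 'g
  Top :: 'g
  Delta :: "'q \<Rightarrow> 'a option \<Rightarrow> 'g \<Rightarrow> ('q \<times> 'g instr) set"
  Start :: 'q
  Final :: "'q set"

definition Stack0 :: "('q, 'a, 'g) sa \<Rightarrow> 'g set" where
  "Stack0 M = Stack M - {Bottom M, Top M}"

text \<open>An input label \<open>None\<close> stands for the empty word. The function \<open>Delta M\<close> is total, so its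
  values outside \<open>States M \<times> (Input M \<union> {\<lambda>}) \<times> Stack M\<close> are never used as transitions.\<close>

definition sa_trans :: "('q, 'a, 'g) sa \<Rightarrow> 'q \<Rightarrow> 'a option \<Rightarrow> 'g \<Rightarrow> 'q \<Rightarrow> 'g instr \<Rightarrow> bool" where
  "sa_trans M q a y p i \<longleftrightarrow>
     q \<in> States M \<and> a \<in> insert None (Some ` Input M) \<and> y \<in> Stack M \<and> (p, i) \<in> Delta M q a y"

definition stack_automaton :: "('q, 'a, 'g) sa \<Rightarrow> bool" where
  "stack_automaton M \<longleftrightarrow>
     finite (States M) \<and> finite (Input M) \<and> finite (Stack M) \<and>
     Bottom M \<in> Stack M \<and> Top M \<in> Stack M \<and> Bottom M \<noteq> Top M \<and>
     Start M \<in> States M \<and> Final M \<subseteq> States M \<and>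
     (\<forall>q a y p i. sa_trans M q a y p i \<longrightarrow>
        p \<in> States M \<and> i \<in> {Stay, Pop, Left, Still, Right} \<union> Push ` Stack0 M)"

fun label_word :: "'a option \<Rightarrow> 'a list" where
  "label_word None = []"
| "label_word (Some a) = [a]"

definition stack_words :: "('q, 'a, 'g) sa \<Rightarrow> 'g list set" where
  "stack_words M = {Bottom M # ys @ [Top M] | ys. ys \<in> lists (Stack0 M)}"

text \<open>A configuration \<open>(q, w, l, r)\<close> has state \<open>q\<close>, remaining input \<open>w\<close> and stack word \<open>l @ r\<close>;
  the head marker sits between \<open>l\<close> and \<open>r\<close>, so that the head scans the last symbol of \<open>l\<close>.\<close>

type_synonym ('q, 'a, 'g) config = "'q \<times> 'a list \<times> 'g list \<times> 'g list"

text \<open>The two markers are not counted.\<close>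

fun config_size :: "('q, 'a, 'g) config \<Rightarrow> nat" where
  "config_size (q, w, l, r) = length (l @ r) - 2"

inductive write_step ::
  "('q, 'a, 'g) sa \<Rightarrow> ('q, 'a, 'g) config \<Rightarrow> ('q, 'a, 'g) config \<Rightarrow> bool"
  for M :: "('q, 'a, 'g) sa" where
  stay: "\<lbrakk>sa_trans M q a x p Stay; x \<in> Stack0 M \<union> {Bottom M}; u \<in> lists (Input M);
      g @ [x, Top M] \<in> stack_words M\<rbrakk> \<Longrightarrow>
    write_step M (q, label_word a @ u, g @ [x], [Top M]) (p, u, g @ [x], [Top M])"
| push: "\<lbrakk>sa_trans M q a x p (Push y); x \<in> Stack0 M \<union> {Bottom M}; u \<in> lists (Input M);
      g @ [x, Top M] \<in> stack_words M\<rbrakk> \<Longrightarrow>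
    write_step M (q, label_word a @ u, g @ [x], [Top M]) (p, u, g @ [x, y], [Top M])"
| pop: "\<lbrakk>sa_trans M q a x p Pop; x \<in> Stack0 M \<union> {Bottom M}; u \<in> lists (Input M);
      g @ [x, Top M] \<in> stack_words M; x \<noteq> Bottom M\<rbrakk> \<Longrightarrow>
    write_step M (q, label_word a @ u, g @ [x], [Top M]) (p, u, g, [Top M])"

inductive read_step ::
  "('q, 'a, 'g) sa \<Rightarrow> ('q, 'a, 'g) config \<Rightarrow> ('q, 'a, 'g) config \<Rightarrow> bool"
  for M :: "('q, 'a, 'g) sa" where
  left: "\<lbrakk>sa_trans M q a x p Left; u \<in> lists (Input M); g1 @ x # g2 \<in> stack_words M;
      x \<noteq> Bottom M\<rbrakk> \<Longrightarrow>
    read_step M (q, label_word a @ u, g1 @ [x], g2) (p, u, g1, x # g2)"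
| still: "\<lbrakk>sa_trans M q a x p Still; u \<in> lists (Input M); g1 @ x # g2 \<in> stack_words M\<rbrakk> \<Longrightarrow>
    read_step M (q, label_word a @ u, g1 @ [x], g2) (p, u, g1 @ [x], g2)"
| right: "\<lbrakk>sa_trans M q a x p Right; u \<in> lists (Input M); g1 @ x # g2 \<in> stack_words M;
      g2 = y # g2'\<rbrakk> \<Longrightarrow>
    read_step M (q, label_word a @ u, g1 @ [x], g2) (p, u, g1 @ [x, y], g2')"

definition sa_step ::
  "('q, 'a, 'g) sa \<Rightarrow> ('q, 'a, 'g) config \<Rightarrow> ('q, 'a, 'g) config \<Rightarrow> bool" where
  "sa_step M c c' \<longleftrightarrow> write_step M c c' \<or> read_step M c c'"

definition partial_computation ::
  "('q, 'a, 'g) sa \<Rightarrow> 'a list \<Rightarrow> ('q, 'a, 'g) config list \<Rightarrow> bool" where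
  "partial_computation M u C \<longleftrightarrow>
     u \<in> lists (Input M) \<and> C \<noteq> [] \<and> hd C = (Start M, u, [Bottom M], [Top M]) \<and>
     successively (sa_step M) C"

definition accepting_computation ::
  "('q, 'a, 'g) sa \<Rightarrow> 'a list \<Rightarrow> ('q, 'a, 'g) config list \<Rightarrow> bool" where
  "accepting_computation M u C \<longleftrightarrow>
     partial_computation M u C \<and> (\<exists>q l r. last C = (q, [], l, r) \<and> q \<in> Final M)"

definition accepted_language :: "('q, 'a, 'g) sa \<Rightarrow> 'a list set" where
  "accepted_language M = {u \<in> lists (Input M). \<exists>C. accepting_computation M u C}"

definition computation_size :: "('q, 'a, 'g) config list \<Rightarrow> nat" where
  "computation_size C = Max (config_size ` set C)"

definition partitioned_by :: "('q, 'a, 'g) sa \<Rightarrow> 'q set \<Rightarrow> 'q set \<Rightarrow> bool" where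
  "partitioned_by M Qw Qr \<longleftrightarrow>
     States M = Qw \<union> Qr \<and> Qw \<inter> Qr = {} \<and> Final M \<subseteq> Qr \<and>
     (\<forall>q a y p i. sa_trans M q a y p i \<longrightarrow> q \<in> Qw \<longrightarrow> i \<in> {Stay, Pop} \<union> range Push) \<and>
     (\<forall>q a y p i. sa_trans M q a y p i \<longrightarrow> q \<in> Qr \<longrightarrow> i \<in> {Left, Still, Right})"

definition non_erasing :: "('q, 'a, 'g) sa \<Rightarrow> bool" where
  "non_erasing M \<longleftrightarrow> (\<forall>q a y p. \<not> sa_trans M q a y p Pop)"

definition checking_stack_automaton :: "('q, 'a, 'g) sa \<Rightarrow> bool" where
  "checking_stack_automaton M \<longleftrightarrow>
     stack_automaton M \<and> non_erasing M \<and>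
     (\<exists>Qw Qr. partitioned_by M Qw Qr \<and>
        (\<forall>q a y p i. sa_trans M q a y p i \<longrightarrow> q \<in> Qr \<longrightarrow> p \<notin> Qw))"

text \<open>In \<open>enat\<close> the supremum of a nonempty set of naturals is its maximum if the set is bounded,
  and \<open>\<infinity>\<close> otherwise; a word over the input alphabet has at least the one-element partial
  computation.\<close>

definition strong_space :: "('q, 'a, 'g) sa \<Rightarrow> 'a list \<Rightarrow> enat" where
  "strong_space M u = (SUP C \<in> {C. partial_computation M u C}. enat (computation_size C))"

definition s_unlimited :: "('q, 'a, 'g) sa \<Rightarrow> bool" where
  "s_unlimited M \<longleftrightarrow> (\<exists>u \<in> lists (Input M). strong_space M u = \<infinity>)"

definition copy_language :: "'a \<Rightarrow> 'a \<Rightarrow> 'a \<Rightarrow> 'a \<Rightarrow> 'a list set" where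
  "copy_language a b dollar hash =
     {u @ [dollar] @ u @ [hash] @ v @ [dollar] @ v | u v. u \<in> lists {a, b} \<and> v \<in> lists {a, b}}"

end

theory Submission
  imports Defs
begin

text \<open>Suppose the automaton is not unlimited. A stack reached in the writing phase is then at most
  linear in the input read so far: on a longer one a pair of state and topmost symbol repeats
  without reading input, and the stack could be enlarged indefinitely. Feed it the words
  \<open>u$u#T\<close> with \<open>T = a^n$a^n\<close>, \<open>|u| = m\<close> and \<open>n\<close> a large constant times \<open>m\<close>. In accepting runs
  with a fixed stack, a state at a fixed head position occurs with at most one remaining input in
  each half of \<open>T\<close>, since otherwise one half could be pumped alone. Hence the stack at the
  symbol \<open>#\<close> is too short for checking \<open>T\<close>, and \<open>u$u#\<close> is read entirely in the writing phase.
  At the boundary \<open>g\<close> between the stack written on \<open>u$\<close> and the rest, only \<open>2|Q|\<close> pairs of state and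
  remaining input occur. The relation which the excursions below \<open>g\<close> induce on these pairs takes
  polynomially many values in \<open>m\<close>, so two words \<open>u \<noteq> u'\<close> share it (with the state and the
  topmost symbol at \<open>g\<close>). Replacing the lower part of the stack then makes \<open>u$u'#T\<close> accepted.\<close>

section \<open>Words of the copy language and stack words\<close>

text \<open>Neither separator occurs in the four blocks, so a word of this shape can be cut in one
  way only: first at its single \<open>hash\<close>, then each side at its single
  \<open>dollar\<close>.\<close>

lemma copy_language_decode:
  assumes d: "distinct [a, b, dollar, hash]"
    and ab: "p \<in> lists {a, b}" "p' \<in> lists {a, b}" "v \<in> lists {a, b}" "v' \<in> lists {a, b}"
    and L: "p @ [dollar] @ p' @ [hash] @ v @ [dollar] @ v' \<in> copy_language a b dollar hash"
  shows "p = p'" and "v = v'"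
proof -
  obtain x y where xy: "x \<in> lists {a, b}" "y \<in> lists {a, b}"
    and eq: "p @ [dollar] @ p' @ [hash] @ v @ [dollar] @ v' =
      x @ [dollar] @ x @ [hash] @ y @ [dollar] @ y"
    using L unfolding copy_language_def by blast
  have notin: "dollar \<notin> set w \<and> hash \<notin> set w" if "w \<in> lists {a, b}" for w
    using that d by (auto simp: in_lists_conv_set)
  have "(p @ dollar # p') @ hash # (v @ dollar # v') =
      (x @ dollar # x) @ hash # (y @ dollar # y)"
    using eq by simp
  moreover have "hash \<notin> set (p @ dollar # p')" "hash \<notin> set (v @ dollar # v')"
    using notin[OF ab(1)] notin[OF ab(2)] notin[OF ab(3)] notin[OF ab(4)] d by auto
  ultimately have "p @ dollar # p' = x @ dollar # x" "v @ dollar # v' = y @ dollar # y"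
    by (metis append_Cons_eq_iff)+
  then show "p = p'" "v = v'"
    using notin[OF ab(1)] notin[OF ab(2)] notin[OF ab(3)] notin[OF ab(4)]
    by (metis append_Cons_eq_iff)+
qed

lemma stack_words_iff:
  assumes "Bottom M \<noteq> Top M"
  shows "g @ [Top M] \<in> stack_words M \<longleftrightarrow> (\<exists>ys \<in> lists (Stack0 M). g = Bottom M # ys)"
  unfolding stack_words_def using assms by (auto simp: Cons_eq_append_conv)

section \<open>Computations as reachability\<close>

definition accepts_from :: "('q, 'a, 'g) sa \<Rightarrow> ('q, 'a, 'g) config \<Rightarrow> bool" where
  "accepts_from M c \<longleftrightarrow> (\<exists>f l r. (sa_step M)\<^sup>*\<^sup>* c (f, [], l, r) \<and> f \<in> Final M)"

abbreviation initial :: "('q, 'a, 'g) sa \<Rightarrow> 'a list \<Rightarrow> ('q, 'a, 'g) config" where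
  "initial M u \<equiv> (Start M, u, [Bottom M], [Top M])"

lemma rtranclp_imp_successively:
  assumes "R\<^sup>*\<^sup>* x y"
  shows "\<exists>C. C \<noteq> [] \<and> hd C = x \<and> last C = y \<and> successively R C"
  using assms
proof (induction rule: rtranclp_induct)
  case base
  show ?case by (intro exI[of _ "[x]"]) auto
next
  case (step y z)
  then obtain C where "C \<noteq> [] \<and> hd C = x \<and> last C = y \<and> successively R C" by blast
  then show ?case using step(2)
    by (intro exI[of _ "C @ [z]"]) (auto simp: successively_append_iff)
qed

lemma successively_imp_rtranclp:
  assumes "C \<noteq> []" "successively R C"
  shows "R\<^sup>*\<^sup>* (hd C) (last C)"
  using assms
proof (induction C rule: induct_list012)
  case (3 x y zs)
  then show ?case by (auto intro: converse_rtranclp_into_rtranclp)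
qed auto

lemma accepted_language_iff:
  "u \<in> accepted_language M \<longleftrightarrow> u \<in> lists (Input M) \<and> accepts_from M (initial M u)"
proof
  assume "u \<in> accepted_language M"
  then obtain C f l r where u: "u \<in> lists (Input M)" and C: "C \<noteq> []" "successively (sa_step M) C"
    "hd C = initial M u" "last C = (f, [], l, r)" "f \<in> Final M"
    unfolding accepted_language_def accepting_computation_def partial_computation_def by auto
  then have "(sa_step M)\<^sup>*\<^sup>* (initial M u) (f, [], l, r)"
    using successively_imp_rtranclp[OF C(1,2)] by simp
  then show "u \<in> lists (Input M) \<and> accepts_from M (initial M u)"
    using u C(5) unfolding accepts_from_def by blast
next
  assume u: "u \<in> lists (Input M) \<and> accepts_from M (initial M u)"
  then obtain f l r where f: "f \<in> Final M" and "(sa_step M)\<^sup>*\<^sup>* (initial M u) (f, [], l, r)"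
    unfolding accepts_from_def by blast
  then obtain C where "C \<noteq> []" "hd C = initial M u" "last C = (f, [], l, r)"
    "successively (sa_step M) C"
    using rtranclp_imp_successively by metis
  then have "accepting_computation M u C"
    unfolding accepting_computation_def partial_computation_def using u f by simp
  then show "u \<in> accepted_language M"
    unfolding accepted_language_def using u by blast
qed

text \<open>Every reachable configuration ends some partial computation, so a finite supremum bounds
  its size. The bound \<open>k\<close> depends on \<open>u\<close>; it serves to make a tallest
  stack exist in \<open>write_bound\<close>.\<close>

lemma reachable_size_bounded:
  assumes "\<not> s_unlimited M" "u \<in> lists (Input M)"
  obtains k where "\<And>c. (sa_step M)\<^sup>*\<^sup>* (initial M u) c \<Longrightarrow> config_size c \<le> k"
proof -
  have "strong_space M u \<noteq> \<infinity>" using assms unfolding s_unlimited_def by auto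
  then obtain k where k: "strong_space M u = enat k" by auto
  have "config_size c \<le> k" if c: "(sa_step M)\<^sup>*\<^sup>* (initial M u) c" for c
  proof -
    obtain C where C: "C \<noteq> []" "hd C = initial M u" "last C = c" "successively (sa_step M) C"
      using rtranclp_imp_successively[OF c] by blast
    then have "enat (computation_size C) \<le> strong_space M u"
      unfolding strong_space_def using assms(2)
      by (intro SUP_upper) (simp add: partial_computation_def)
    moreover have "config_size c \<le> computation_size C"
      unfolding computation_size_def using C by (intro Max_ge) auto
    ultimately show ?thesis using k by simp
  qed
  then show thesis using that by blast
qed

section \<open>Consumption of the input\<close>

lemma length_label_word: "length (label_word a) \<le> 1"
  by (cases a) auto

text \<open>A step inspects of the input only the prefix \<open>z\<close> that it reads, so any
  other remaining input \<open>w0\<close> may follow \<open>z\<close>. The bound on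
  \<open>length z\<close> is what \<open>intermediate_input\<close> builds on.\<close>

lemma write_step_consume:
  assumes "write_step M (q, w, l, r) (p, w', l', r')"
  shows "\<exists>z. length z \<le> 1 \<and> w = z @ w' \<and>
    (\<forall>w0 \<in> lists (Input M). write_step M (q, z @ w0, l, r) (p, w0, l', r'))"
  using assms
proof cases
  case (stay a x g)
  then show ?thesis using length_label_word by (metis write_step.stay)
next
  case (push a x y g)
  then show ?thesis using length_label_word by (metis write_step.push)
next
  case (pop a x)
  then show ?thesis using length_label_word by (metis write_step.pop)
qed

lemma read_step_consume:
  assumes "read_step M (q, w, l, r) (p, w', l', r')"
  shows "\<exists>z. length z \<le> 1 \<and> w = z @ w' \<and>
    (\<forall>w0 \<in> lists (Input M). read_step M (q, z @ w0, l, r) (p, w0, l', r'))"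
  using assms
proof cases
  case (left a x)
  then show ?thesis using length_label_word by (metis read_step.left)
next
  case (still a x g)
  then show ?thesis using length_label_word by (metis read_step.still)
next
  case (right a x g y)
  then show ?thesis using length_label_word by (metis read_step.right)
qed

lemma write_step_letter: "write_step M (q, w, l, r) (p, w', l', r') \<Longrightarrow> \<exists>z. length z \<le> 1 \<and> w = z @ w'"
  by (drule write_step_consume) (elim exE conjE, intro exI conjI)

lemma read_step_letter: "read_step M (q, w, l, r) (p, w', l', r') \<Longrightarrow> \<exists>z. length z \<le> 1 \<and> w = z @ w'"
  by (drule read_step_consume) (elim exE conjE, intro exI conjI)

lemma sa_step_consume:
  assumes "sa_step M (q, w, l, r) (p, w', l', r')"
  shows "\<exists>z. length z \<le> 1 \<and> w = z @ w' \<and>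
    (\<forall>w0 \<in> lists (Input M). sa_step M (q, z @ w0, l, r) (p, w0, l', r'))"
  using assms write_step_consume read_step_consume unfolding sa_step_def by metis

lemma sa_steps_consume:
  assumes "(sa_step M)\<^sup>*\<^sup>* (q, w, l, r) (p, w', l', r')"
  shows "\<exists>z. w = z @ w' \<and>
    (\<forall>w0 \<in> lists (Input M). z \<in> lists (Input M) \<longrightarrow> (sa_step M)\<^sup>*\<^sup>* (q, z @ w0, l, r) (p, w0, l', r'))"
  using assms
proof (induction "(p, w', l', r')" arbitrary: p w' l' r' rule: rtranclp_induct)
  case base
  then show ?case by auto
next
  case (step y)
  obtain p1 w1 l1 r1 where y: "y = (p1, w1, l1, r1)" by (cases y)
  obtain z where z: "w = z @ w1"
    "\<And>w0. \<lbrakk>w0 \<in> lists (Input M); z \<in> lists (Input M)\<rbrakk> \<Longrightarrow> (sa_step M)\<^sup>*\<^sup>* (q, z @ w0, l, r) (p1, w0, l1, r1)"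
    using step(3)[OF y] by blast
  obtain z' where z': "w1 = z' @ w'"
    "\<And>w0. w0 \<in> lists (Input M) \<Longrightarrow> sa_step M (p1, z' @ w0, l1, r1) (p, w0, l', r')"
    using sa_step_consume[OF step(2)[unfolded y]] by blast
  have "(sa_step M)\<^sup>*\<^sup>* (q, (z @ z') @ w0, l, r) (p, w0, l', r')"
    if "w0 \<in> lists (Input M)" "z @ z' \<in> lists (Input M)" for w0
    using z(2)[of "z' @ w0"] z'(2)[OF that(1)] that by (auto intro: rtranclp.rtrancl_into_rtrancl)
  then show ?case using z(1) z'(1) by (intro exI[of _ "z @ z'"]) auto
qed

lemma sa_steps_suffix:
  assumes "(sa_step M)\<^sup>*\<^sup>* (q, w, l, r) (p, w', l', r')"
  shows "\<exists>z. w = z @ w'"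
  using sa_steps_consume[OF assms] by (elim exE conjE) (rule exI)

text \<open>A discrete intermediate value argument: at most one letter disappears per step, so the
  remaining input cannot skip \<open>y\<close> while shrinking to \<open>w'\<close>. The relation
  \<open>R\<close> is kept general to cover both write steps and read steps.\<close>

lemma intermediate_input:
  assumes one: "\<And>q w l r p w' l' r'. R (q, w, l, r) (p, w', l', r') \<Longrightarrow> \<exists>z. length z \<le> 1 \<and> w = z @ w'"
    and run: "R\<^sup>*\<^sup>* (q, x @ y, l, r) (p, w', l', r')" and len: "length w' \<le> length y"
  shows "\<exists>q1 l1 r1. R\<^sup>*\<^sup>* (q, x @ y, l, r) (q1, y, l1, r1) \<and> R\<^sup>*\<^sup>* (q1, y, l1, r1) (p, w', l', r')"
  using run
proof (induction "(q, x @ y, l, r)" arbitrary: q x l r rule: converse_rtranclp_induct)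
  case base
  then have "x = []" using len by simp
  with base show ?case by (intro exI[of _ p] exI[of _ l'] exI[of _ r']) simp
next
  case (step c)
  obtain q2 w2 l2 r2 where c: "c = (q2, w2, l2, r2)" by (cases c)
  have R: "R (q, x @ y, l, r) (q2, w2, l2, r2)" using step(1) c by simp
  obtain z where z: "length z \<le> 1" "x @ y = z @ w2" using one[OF R] by blast
  show ?case
  proof (cases "x = []")
    case True
    then show ?thesis using step(1,2) by (auto intro: converse_rtranclp_into_rtranclp)
  next
    case False
    then have "length z \<le> length x" using z(1) by (cases x) auto
    then obtain x' where x': "w2 = x' @ y" using z(2) by (auto simp: append_eq_append_conv2)
    with step(3) c obtain q1 l1 r1 where "R\<^sup>*\<^sup>* c (q1, y, l1, r1)" "R\<^sup>*\<^sup>* (q1, y, l1, r1) (p, w', l', r')"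
      by blast
    then show ?thesis using step(1) by (blast intro: converse_rtranclp_into_rtranclp)
  qed
qed

lemma write_steps_intermediate_input:
  assumes "(write_step M)\<^sup>*\<^sup>* (q, x @ y, l, r) (p, w', l', r')" "length w' \<le> length y"
  shows "\<exists>q1 l1 r1. (write_step M)\<^sup>*\<^sup>* (q, x @ y, l, r) (q1, y, l1, r1) \<and>
    (write_step M)\<^sup>*\<^sup>* (q1, y, l1, r1) (p, w', l', r')"
  by (rule intermediate_input[OF _ assms]) (rule write_step_letter)

lemma read_steps_intermediate_input:
  assumes "(read_step M)\<^sup>*\<^sup>* (q, x @ y, l, r) (p, w', l', r')" "length w' \<le> length y"
  shows "\<exists>q1 l1 r1. (read_step M)\<^sup>*\<^sup>* (q, x @ y, l, r) (q1, y, l1, r1) \<and>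
    (read_step M)\<^sup>*\<^sup>* (q1, y, l1, r1) (p, w', l', r')"
  by (rule intermediate_input[OF _ assms]) (rule read_step_letter)

section \<open>Writing phase and reading phase of a checking stack automaton\<close>

locale csa =
  fixes M :: "('q, 'a, 'g) sa" and Qw Qr :: "'q set"
  assumes automaton: "stack_automaton M" and non_erasing: "non_erasing M"
    and partitioned: "partitioned_by M Qw Qr"
    and no_return: "\<And>q a y p i. \<lbrakk>sa_trans M q a y p i; q \<in> Qr\<rbrakk> \<Longrightarrow> p \<notin> Qw"
begin

lemma Bottom_neq_Top: "Bottom M \<noteq> Top M"
  using automaton unfolding stack_automaton_def by auto

lemmas word_iff = stack_words_iff[OF Bottom_neq_Top]

lemma word_append: "\<lbrakk>g @ [Top M] \<in> stack_words M; s \<in> lists (Stack0 M)\<rbrakk> \<Longrightarrow> (g @ s) @ [Top M] \<in> stack_words M"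
  unfolding word_iff by auto

lemma initial_word: "[Bottom M] @ [Top M] \<in> stack_words M"
  unfolding word_iff by auto

lemma last_in_Stack:
  assumes "g @ [Top M] \<in> stack_words M"
  shows "last g \<in> Stack M"
proof -
  obtain ys where ys: "g = Bottom M # ys" "set ys \<subseteq> Stack0 M"
    using assms unfolding word_iff by (auto simp: in_lists_conv_set)
  have "last g \<in> set g" using ys by auto
  moreover have "set g \<subseteq> Stack M"
    using ys automaton by (auto simp: stack_automaton_def Stack0_def)
  ultimately show ?thesis by blast
qed

lemma sa_step_states:
  assumes "sa_step M (q, w, l, r) (p, w', l', r')"
  shows "q \<in> States M" "p \<in> States M"
proof -
  obtain a x i where "sa_trans M q a x p i"
    using assms unfolding sa_step_def
    by (auto elim: write_step.cases read_step.cases)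
  then show "q \<in> States M" "p \<in> States M"
    using automaton unfolding stack_automaton_def sa_trans_def by blast+
qed

lemma sa_steps_states:
  assumes "(sa_step M)\<^sup>*\<^sup>* (q, w, l, r) (p, w', l', r')" "q \<in> States M"
  shows "p \<in> States M"
  using assms by (cases rule: rtranclp.cases) (auto dest: sa_step_states)

lemma trans_states:
  assumes "sa_trans M q a x p i"
  shows "q \<in> Qw \<or> q \<in> Qr" "p \<in> Qw \<or> p \<in> Qr"
proof -
  have "States M = Qw \<union> Qr" using partitioned unfolding partitioned_by_def by (elim conjE)
  moreover have "q \<in> States M" using assms unfolding sa_trans_def by (elim conjE)
  moreover have "p \<in> States M" using assms automaton unfolding stack_automaton_def by blast
  ultimately show "q \<in> Qw \<or> q \<in> Qr" "p \<in> Qw \<or> p \<in> Qr" by auto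
qed

lemma write_trans:
  assumes "sa_trans M q a x p i" "q \<in> Qw"
  shows "i \<notin> {Left, Still, Right}"
proof -
  have "\<forall>q a y p i. sa_trans M q a y p i \<longrightarrow> q \<in> Qw \<longrightarrow> i \<in> {Stay, Pop} \<union> range Push"
    using partitioned unfolding partitioned_by_def by (elim conjE)
  then have "i \<in> {Stay, Pop} \<union> range Push" using assms by metis
  then show ?thesis by auto
qed

lemma read_trans:
  assumes "sa_trans M q a x p i" "q \<in> Qr"
  shows "i \<in> {Left, Still, Right}"
proof -
  have "\<forall>q a y p i. sa_trans M q a y p i \<longrightarrow> q \<in> Qr \<longrightarrow> i \<in> {Left, Still, Right}"
    using partitioned unfolding partitioned_by_def by (elim conjE)
  then show ?thesis using assms by metis
qed

lemma write_step_state: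
  assumes "write_step M (q, w, l, r) c"
  shows "q \<in> Qw"
proof -
  obtain a x p i where t: "sa_trans M q a x p i" "i \<notin> {Left, Still, Right}"
    using assms by cases blast+
  show ?thesis using trans_states(1)[OF t(1)] read_trans[OF t(1)] t(2) by blast
qed

lemma read_step_state:
  assumes "read_step M (q, w, l, r) (p, w', l', r')"
  shows "q \<in> Qr" "p \<in> Qr"
proof -
  obtain a x i where t: "sa_trans M q a x p i" "i \<in> {Left, Still, Right}"
    using assms by cases blast+
  show q: "q \<in> Qr" using trans_states(1)[OF t(1)] write_trans[OF t(1)] t(2) by blast
  show "p \<in> Qr" using trans_states(2)[OF t(1)] no_return[OF t(1) q] by blast
qed

text \<open>Read steps end in \<open>Qr\<close> and write steps start in \<open>Qw\<close>, so no
  write step can follow a read step.\<close>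

lemma write_read_decomposition:
  assumes "(sa_step M)\<^sup>*\<^sup>* c d"
  shows "\<exists>e. (write_step M)\<^sup>*\<^sup>* c e \<and> (read_step M)\<^sup>*\<^sup>* e d"
  using assms
proof (induction rule: rtranclp_induct)
  case base
  then show ?case by blast
next
  case (step y z)
  then obtain e where e: "(write_step M)\<^sup>*\<^sup>* c e" "(read_step M)\<^sup>*\<^sup>* e y" by blast
  consider (r) "read_step M y z" | (w) "write_step M y z"
    using step(2) unfolding sa_step_def by blast
  then show ?case
  proof cases
    case r
    then show ?thesis using e by (meson rtranclp.rtrancl_into_rtrancl)
  next
    case w
    \<comment> \<open>A last read step would put the state of \<open>y\<close> into both
      \<open>Qr\<close> and \<open>Qw\<close>.\<close>
    have "e = y" using e(2)
    proof (cases rule: rtranclp.cases)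
      case (rtrancl_into_rtrancl b)
      obtain q w' l r where y: "y = (q, w', l, r)" by (cases y)
      have "q \<in> Qr" using rtrancl_into_rtrancl(2) read_step_state(2) y by (cases b) auto
      moreover have "q \<in> Qw" using w write_step_state y by auto
      ultimately show ?thesis using partitioned unfolding partitioned_by_def by auto
    qed auto
    then show ?thesis using e w by (meson rtranclp.rtrancl_into_rtrancl rtranclp.rtrancl_refl)
  qed
qed

section \<open>Replaying writing phases on other stacks\<close>

text \<open>A write step sees only the topmost symbol and, in the absence of \<open>Pop\<close>,
  just appends a word \<open>s\<close>. It can thus be repeated above any stack word
  \<open>l0\<close> ending in the same symbol.\<close>

lemma write_step_replay:
  assumes "write_step M (q, w, l, r) (p, w', l', r')"
  shows "r = [Top M] \<and> r' = [Top M] \<and> (\<exists>z s. length s \<le> 1 \<and> s \<in> lists (Stack0 M) \<and> w = z @ w' \<and> l' = l @ s \<and>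
    (\<forall>w0 \<in> lists (Input M). \<forall>l0. l0 @ [Top M] \<in> stack_words M \<longrightarrow> last l0 = last l \<longrightarrow>
       write_step M (q, z @ w0, l0, [Top M]) (p, w0, l0 @ s, [Top M])))"
  using assms
proof cases
  case (stay a x g)
  have "write_step M (q, label_word a @ w0, l0, [Top M]) (p, w0, l0 @ [], [Top M])"
    if "w0 \<in> lists (Input M)" "l0 @ [Top M] \<in> stack_words M" "last l0 = last l" for w0 l0
  proof -
    have "l0 \<noteq> []" "last l0 = x" using that(2,3) stay by (auto simp: word_iff)
    then obtain g0 where g0: "l0 = g0 @ [x]" by (metis append_butlast_last_id)
    then show ?thesis using write_step.stay[OF stay(6,7) that(1), of g0] that(2) by simp
  qed
  then show ?thesis using stay by (intro conjI exI[of _ "label_word a"] exI[of _ "[]"]) auto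
next
  case (push a x y g)
  have "write_step M (q, label_word a @ w0, l0, [Top M]) (p, w0, l0 @ [y], [Top M])"
    if "w0 \<in> lists (Input M)" "l0 @ [Top M] \<in> stack_words M" "last l0 = last l" for w0 l0
  proof -
    have "l0 \<noteq> []" "last l0 = x" using that(2,3) push by (auto simp: word_iff)
    then obtain g0 where g0: "l0 = g0 @ [x]" by (metis append_butlast_last_id)
    then show ?thesis using write_step.push[OF push(6,7) that(1), of g0] that(2) by simp
  qed
  moreover have "y \<in> Stack0 M"
    using push(6) automaton unfolding stack_automaton_def by blast
  ultimately show ?thesis using push by (intro conjI exI[of _ "label_word a"] exI[of _ "[y]"]) auto
next
  case (pop a x)
  then show ?thesis using non_erasing unfolding non_erasing_def by blast
qed

text \<open>Since nothing is erased, the stack \<open>l\<close> is never scanned below its last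
  symbol. This is used to pump a writing phase and to transplant one onto another stack.\<close>

lemma write_steps_replay:
  assumes "(write_step M)\<^sup>*\<^sup>* (q, w, l, [Top M]) (p, w', l', r')" "l @ [Top M] \<in> stack_words M"
  shows "r' = [Top M] \<and> (\<exists>z s. s \<in> lists (Stack0 M) \<and> w = z @ w' \<and> l' = l @ s \<and>
    (\<forall>w0 \<in> lists (Input M). z \<in> lists (Input M) \<longrightarrow>
      (\<forall>l0. l0 @ [Top M] \<in> stack_words M \<longrightarrow> last l0 = last l \<longrightarrow>
       (write_step M)\<^sup>*\<^sup>* (q, z @ w0, l0, [Top M]) (p, w0, l0 @ s, [Top M]))))"
  using assms(1)
proof (induction "(p, w', l', r')" arbitrary: p w' l' r' rule: rtranclp_induct)
  case base
  show ?case by (intro conjI exI[of _ "[]"]) (use base in auto)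
next
  case (step y)
  obtain p1 w1 l1 r1 where y: "y = (p1, w1, l1, r1)" by (cases y)
  obtain z s where zs: "r1 = [Top M]" "s \<in> lists (Stack0 M)" "w = z @ w1" "l1 = l @ s"
    "\<And>w0 l0. \<lbrakk>w0 \<in> lists (Input M); z \<in> lists (Input M); l0 @ [Top M] \<in> stack_words M; last l0 = last l\<rbrakk> \<Longrightarrow>
       (write_step M)\<^sup>*\<^sup>* (q, z @ w0, l0, [Top M]) (p1, w0, l0 @ s, [Top M])"
    using step(3)[OF y] by blast
  obtain z' s' where zs': "r' = [Top M]" "s' \<in> lists (Stack0 M)" "w1 = z' @ w'" "l' = l1 @ s'"
    "\<And>w0 l0. \<lbrakk>w0 \<in> lists (Input M); l0 @ [Top M] \<in> stack_words M; last l0 = last l1\<rbrakk> \<Longrightarrow>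
       write_step M (p1, z' @ w0, l0, [Top M]) (p, w0, l0 @ s', [Top M])"
    using write_step_replay[OF step(2)[unfolded y]] by blast
  have "(write_step M)\<^sup>*\<^sup>* (q, (z @ z') @ w0, l0, [Top M]) (p, w0, l0 @ s @ s', [Top M])"
    if a: "w0 \<in> lists (Input M)" "z @ z' \<in> lists (Input M)" "l0 @ [Top M] \<in> stack_words M"
      "last l0 = last l" for w0 l0
  proof -
    have "(write_step M)\<^sup>*\<^sup>* (q, z @ z' @ w0, l0, [Top M]) (p1, z' @ w0, l0 @ s, [Top M])"
      using a by (intro zs(5)) auto
    \<comment> \<open>The topmost symbols still agree: either both are the last symbol of
      \<open>s\<close>, or \<open>s\<close> is empty and the assumption on \<open>l0\<close>
      applies.\<close>
    moreover have "write_step M (p1, z' @ w0, l0 @ s, [Top M]) (p, w0, (l0 @ s) @ s', [Top M])"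
      using a(1,4) word_append[OF a(3) zs(2)] zs(4) assms(2) a(3)
      by (intro zs'(5)) (auto simp: last_append)
    ultimately show ?thesis by simp
  qed
  then show ?case using zs zs' by (intro conjI exI[of _ "z @ z'"] exI[of _ "s @ s'"]) auto
qed

lemma write_steps_word:
  assumes "(write_step M)\<^sup>*\<^sup>* (q, w, l, [Top M]) (p, w', l', r')" "l @ [Top M] \<in> stack_words M"
  shows "l' @ [Top M] \<in> stack_words M"
proof -
  obtain s where "s \<in> lists (Stack0 M)" "l' = l @ s"
    using write_steps_replay[OF assms] by (elim conjE exE)
  then show ?thesis using word_append[OF assms(2)] by simp
qed

text \<open>The counterpart of \<open>intermediate_input\<close> for stacks: a write step adds at
  most one symbol, so no length is skipped.\<close>

lemma intermediate_size:
  assumes "(write_step M)\<^sup>*\<^sup>* (q, w, l, [Top M]) (p, w', l', r')" "length l \<le> i" "i \<le> length l'"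
  shows "\<exists>q1 w1 l1. (write_step M)\<^sup>*\<^sup>* (q, w, l, [Top M]) (q1, w1, l1, [Top M]) \<and> length l1 = i \<and>
    (write_step M)\<^sup>*\<^sup>* (q1, w1, l1, [Top M]) (p, w', l', r')"
  using assms(1,2)
proof (induction "(q, w, l, [Top M])" arbitrary: q w l rule: converse_rtranclp_induct)
  case base
  then show ?case using assms(3) by auto
next
  case (step c)
  obtain q2 w2 l2 r2 where c: "c = (q2, w2, l2, r2)" by (cases c)
  have r2: "r2 = [Top M]" "length l2 \<le> Suc (length l)"
    using write_step_replay[OF step(1)[unfolded c]] by auto
  show ?case
  proof (cases "length l = i")
    case True
    then show ?thesis using step(1,2)
      by (intro exI[of _ q] exI[of _ w] exI[of _ l]) (auto intro: converse_rtranclp_into_rtranclp)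
  next
    case False
    then have "length l2 \<le> i" using r2(2) step(4) by simp
    with step(3) c r2(1) obtain q1 w1 l1 where "(write_step M)\<^sup>*\<^sup>* c (q1, w1, l1, [Top M])"
      "length l1 = i" "(write_step M)\<^sup>*\<^sup>* (q1, w1, l1, [Top M]) (p, w', l', r')"
      by blast
    then show ?thesis using step(1) by (blast intro: converse_rtranclp_into_rtranclp)
  qed
qed

section \<open>Linear bound on the written stack\<close>

lemma write_steps_imp_sa_steps: "(write_step M)\<^sup>*\<^sup>* c d \<Longrightarrow> (sa_step M)\<^sup>*\<^sup>* c d"
  by (erule mono_rtranclp[rule_format, rotated]) (simp add: sa_step_def)

lemma read_steps_imp_sa_steps: "(read_step M)\<^sup>*\<^sup>* c d \<Longrightarrow> (sa_step M)\<^sup>*\<^sup>* c d"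
  by (erule mono_rtranclp[rule_format, rotated]) (simp add: sa_step_def)

text \<open>Pumping on a tallest stack reachable with \<open>w\<close> left to read. If it exceeds
  the bound, two of its heights agree in state, topmost symbol and remaining input; what follows the
  lower one can be repeated from the higher one, ending with the same \<open>w\<close> but a taller
  stack.\<close>

lemma write_bound:
  assumes limited: "\<not> s_unlimited M" and u: "u \<in> lists (Input M)"
    and run: "(write_step M)\<^sup>*\<^sup>* (initial M u) (p, w, l, r)"
  shows "length l \<le> card (States M) * card (Stack M) * (length u - length w + 1)"
proof -
  let ?reach = "\<lambda>p l r. (write_step M)\<^sup>*\<^sup>* (initial M u) (p, w, l, r)"
  define S where "S = {length l | p l r. ?reach p l r}"
  obtain k where k: "\<And>c. (sa_step M)\<^sup>*\<^sup>* (initial M u) c \<Longrightarrow> config_size c \<le> k"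
    using reachable_size_bounded[OF limited u] by blast
  \<comment> \<open>The two markers are left out of \<open>config_size\<close>, hence the summand
    2.\<close>
  have "x \<le> k + 2" if x: "x \<in> S" for x
  proof -
    obtain p' l' r' where x': "x = length l'" "?reach p' l' r'" using x unfolding S_def by blast
    have "config_size (p', w, l', r') \<le> k" using k[OF write_steps_imp_sa_steps[OF x'(2)]] .
    then show ?thesis using x'(1) by simp
  qed
  then have fin: "finite S" by (meson finite_nat_set_iff_bounded_le)
  have "length l \<in> S" using run unfolding S_def by blast
  then have le: "length l \<le> Max S" and "Max S \<in> S" using fin by (auto intro: Max_in)
  then obtain p' l' r' where max: "Max S = length l'" "?reach p' l' r'" unfolding S_def by blast
  have "length l' \<le> card (States M) * card (Stack M) * (length u - length w + 1)"
  proof (rule ccontr)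
    assume big: "\<not> ?thesis"
    have "\<forall>i \<in> {1..length l'}. \<exists>q1 w1 l1. (write_step M)\<^sup>*\<^sup>* (initial M u) (q1, w1, l1, [Top M]) \<and>
        length l1 = i \<and> (write_step M)\<^sup>*\<^sup>* (q1, w1, l1, [Top M]) (p', w, l', r')"
      using intermediate_size[OF max(2)] by simp
    then obtain q1 w1 l1 where mid: "\<And>i. i \<in> {1..length l'} \<Longrightarrow>
        (write_step M)\<^sup>*\<^sup>* (initial M u) (q1 i, w1 i, l1 i, [Top M]) \<and> length (l1 i) = i \<and>
        (write_step M)\<^sup>*\<^sup>* (q1 i, w1 i, l1 i, [Top M]) (p', w, l', r')"
      by metis
    have word: "l1 i @ [Top M] \<in> stack_words M" "w1 i \<in> lists (Input M)"
      "\<exists>z. u = z @ w1 i" "\<exists>z. w1 i = z @ w" if i: "i \<in> {1..length l'}" for i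
    proof -
      have 1: "(write_step M)\<^sup>*\<^sup>* (initial M u) (q1 i, w1 i, l1 i, [Top M])"
        and 2: "(write_step M)\<^sup>*\<^sup>* (q1 i, w1 i, l1 i, [Top M]) (p', w, l', r')"
        using mid[OF i] by auto
      show "l1 i @ [Top M] \<in> stack_words M"
        using write_steps_word[OF 1 initial_word] by simp
      show ex: "\<exists>z. u = z @ w1 i" using sa_steps_suffix[OF write_steps_imp_sa_steps[OF 1]] .
      then show "w1 i \<in> lists (Input M)" using u by auto
      show "\<exists>z. w1 i = z @ w" using sa_steps_suffix[OF write_steps_imp_sa_steps[OF 2]] .
    qed
    \<comment> \<open>Remaining inputs are suffixes of \<open>u\<close>, so their lengths identify
      them; the third component takes at most \<open>length u - length w + 1\<close> values.\<close>
    define f where "f i = (q1 i, last (l1 i), length (w1 i))" for i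
    let ?B = "States M \<times> Stack M \<times> {length w..length u}"
    have "f ` {1..length l'} \<subseteq> ?B"
    proof (rule image_subsetI)
      fix i assume i: "i \<in> {1..length l'}"
      have "Start M \<in> States M" using automaton unfolding stack_automaton_def by blast
      then have "q1 i \<in> States M"
        using mid[OF i] sa_steps_states write_steps_imp_sa_steps by blast
      then show "f i \<in> ?B"
        using word[OF i] last_in_Stack[OF word(1)[OF i]] unfolding f_def by auto
    qed
    moreover have "finite ?B" using automaton unfolding stack_automaton_def by blast
    moreover have "card ?B < card {1..length l'}"
    proof -
      have "length w \<le> length u"
        using sa_steps_suffix[OF write_steps_imp_sa_steps[OF run]] by auto
      then have "card ?B = card (States M) * card (Stack M) * (length u - length w + 1)"
        by (simp add: card_cartesian_product Suc_diff_le distrib_left mult.assoc)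
      then show ?thesis using big by simp
    qed
    ultimately have "\<not> inj_on f {1..length l'}"
      by (meson card_inj_on_le leD)
    then obtain i j where ij: "i \<in> {1..length l'}" "j \<in> {1..length l'}" "f i = f j" "i < j"
      unfolding inj_on_def by (metis linorder_neqE_nat)
    have same: "q1 i = q1 j" "last (l1 i) = last (l1 j)" "w1 i = w1 j"
      using ij(3) word(3)[OF ij(1)] word(3)[OF ij(2)] unfolding f_def
      by (auto simp: append_eq_append_conv)
    obtain z s where zs: "w1 i = z @ w" "l' = l1 i @ s"
      "\<And>w0 l0. \<lbrakk>w0 \<in> lists (Input M); z \<in> lists (Input M); l0 @ [Top M] \<in> stack_words M; last l0 = last (l1 i)\<rbrakk> \<Longrightarrow>
         (write_step M)\<^sup>*\<^sup>* (q1 i, z @ w0, l0, [Top M]) (p', w0, l0 @ s, [Top M])"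
      using write_steps_replay[of "q1 i" "w1 i" "l1 i" p' w l' r'] mid[OF ij(1)] word(1)[OF ij(1)] by blast
    \<comment> \<open>The continuation from height \<open>i\<close>, replayed above the stack of
      height \<open>j\<close>, ends \<open>j - i\<close> symbols above the maximum.\<close>
    have "(write_step M)\<^sup>*\<^sup>* (q1 i, z @ w, l1 j, [Top M]) (p', w, l1 j @ s, [Top M])"
      using zs(1) word(1)[OF ij(2)] word(2)[OF ij(1)] same(2) by (intro zs(3)) auto
    then have "?reach p' (l1 j @ s) [Top M]"
      using rtranclp_trans[of "write_step M" "initial M u" "(q1 j, w1 j, l1 j, [Top M])"]
        mid[OF ij(2)] same(1,3) zs(1) by simp
    then have "length (l1 j @ s) \<in> S" unfolding S_def by blast
    then have "length (l1 j @ s) \<le> length l'" using fin max(1) by (metis Max_ge)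
    then show False using zs(2) mid[OF ij(1)] mid[OF ij(2)] ij(4) by simp
  qed
  then show ?thesis using le max(1) by simp
qed

lemma accepts_from_steps: "\<lbrakk>(sa_step M)\<^sup>*\<^sup>* c d; accepts_from M d\<rbrakk> \<Longrightarrow> accepts_from M c"
  unfolding accepts_from_def by (meson rtranclp_trans)

lemma read_step_imp_sa_step: "read_step M c d \<Longrightarrow> sa_step M c d"
  unfolding sa_step_def by blast

text \<open>Myhill-Nerode exchange: when \<open>w\<close> is left over, exactly \<open>x\<close> has
  been read, and the run so far does not depend on \<open>w\<close>.\<close>

lemma swap_input:
  assumes "(sa_step M)\<^sup>*\<^sup>* (initial M (x @ w)) (q, w, l, r)" "accepts_from M (q, w', l, r)"
    and "x \<in> lists (Input M)" "w' \<in> lists (Input M)"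
  shows "x @ w' \<in> accepted_language M"
proof -
  obtain z where z: "x @ w = z @ w"
    "\<forall>w0 \<in> lists (Input M). z \<in> lists (Input M) \<longrightarrow> (sa_step M)\<^sup>*\<^sup>* (initial M (z @ w0)) (q, w0, l, r)"
    using sa_steps_consume[OF assms(1)] by (elim exE conjE)
  then have "z = x" by simp
  then have "(sa_step M)\<^sup>*\<^sup>* (initial M (x @ w')) (q, w', l, r)"
    using z(2) assms(3,4) by simp
  then show ?thesis
    unfolding accepted_language_iff using accepts_from_steps assms by simp
qed

section \<open>Locality of read steps\<close>

lemma read_step_word:
  assumes "read_step M (q, w, l, r) (p, w', l', r')"
  shows "l' @ r' = l @ r" "length l' \<le> Suc (length l)" "length l \<le> Suc (length l')"
  using assms by (cases; simp)+

lemma read_steps_word: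
  assumes "(read_step M)\<^sup>*\<^sup>* (q, w, l, r) (p, w', l', r')"
  shows "l' @ r' = l @ r"
  using assms
proof (induction "(p, w', l', r')" arbitrary: p w' l' r' rule: rtranclp_induct)
  case (step y)
  obtain p1 w1 l1 r1 where y: "y = (p1, w1, l1, r1)" by (cases y)
  show ?case using read_step_word(1)[OF step(2)[unfolded y]] step(3)[OF y] by simp
qed simp

text \<open>The suffix \<open>t\<close> lies to the right of the head before and after the step, so
  its contents have no influence. The second assumption keeps the new stack word well
  formed.\<close>

lemma left_transfer:
  assumes "read_step M (q, w, l, r @ t) (p, w', l', r' @ t)" "l @ r @ t' \<in> stack_words M"
  shows "read_step M (q, w, l, r @ t') (p, w', l', r' @ t')"
  using assms(1)
proof cases
  case (left a x)
  then show ?thesis using read_step.left[of M q a x p w' l' "r @ t'"] assms(2) by simp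
next
  case (still a x g)
  then show ?thesis using read_step.still[of M q a x p w' g "r @ t'"] assms(2) by simp
next
  case (right a x g y)
  then show ?thesis using read_step.right[of M q a x p w' g "r @ t'" y "r' @ t'"] assms(2) by simp
qed

text \<open>The head stays on or above the last symbol of the lower part, so this symbol is all that
  the step can see of it; it is scanned when \<open>l\<close> is empty.\<close>

lemma right_transfer:
  assumes "read_step M (q, w, g @ l, r) (p, w', g @ l', r')" "(g' @ l) @ r \<in> stack_words M"
    and "g \<noteq> []" "g' \<noteq> []" "last g = last g'"
  shows "read_step M (q, w, g' @ l, r) (p, w', g' @ l', r')"
proof -
  have last: "last (g @ l) = last (g' @ l)" "g' @ l \<noteq> []" using assms(3-5) by (auto simp: last_append)
  obtain k where k: "g' @ l = k @ [last (g @ l)]" using last by (metis append_butlast_last_id)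
  show ?thesis using assms(1)
  proof cases
    case (left a x)
    \<comment> \<open>A left move with \<open>l = []\<close> would leave a left part shorter than
      \<open>g\<close>.\<close>
    then have "l \<noteq> []" by (metis append_Nil2 append_eq_append_conv2 not_Cons_self2 append_self_conv append.assoc Nil_is_append_conv)
    then have "l = l' @ [x]" using left by (metis append.assoc same_append_eq append_butlast_last_id snoc_eq_iff_butlast butlast_append)
    then show ?thesis using left read_step.left[of M q a x p w' "g' @ l'" r] assms(2) by simp
  next
    case (still a x g1)
    then have "g @ l' = g @ l" by metis
    then have l: "l' = l" by simp
    have k': "g' @ l = k @ [x]" using k still(2) by simp
    then have "k @ x # r \<in> stack_words M" using assms(2) by simp
    from read_step.still[OF still(5,6) this] show ?thesis unfolding l k' still(1,4) .
  next
    case (right a x g1 y)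
    then have "g @ l' = g @ l @ [y]" by simp
    then have "l' = l @ [y]" by simp
    moreover have "k @ [x] = g' @ l" using k right by simp
    ultimately show ?thesis using right read_step.right[of M q a x p w' k r y r'] assms(2)
      by (metis append.assoc append_Cons append_Nil)
  qed
qed

section \<open>Excursions below a boundary of the stack\<close>

text \<open>Read steps on an incomplete stack \<open>l @ r\<close>. The appended
  \<open>Top M\<close> merely completes it to a stack word, since it stays to the right of the head;
  the relation thus does not mention what lies above the boundary.\<close>

definition left_step :: "('q, 'a, 'g) config \<Rightarrow> ('q, 'a, 'g) config \<Rightarrow> bool" where
  "left_step c d = (case (c, d) of ((q, w, l, r), (q', w', l', r')) \<Rightarrow>
     read_step M (q, w, l, r @ [Top M]) (q', w', l', r' @ [Top M]))"

lemma left_steps_embed: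
  assumes "left_step\<^sup>*\<^sup>* (q, w, l, r) (p, w', l', r')" "l @ r @ t \<in> stack_words M"
  shows "l' @ r' = l @ r \<and> (read_step M)\<^sup>*\<^sup>* (q, w, l, r @ t) (p, w', l', r' @ t)"
  using assms(1)
proof (induction "(p, w', l', r')" arbitrary: p w' l' r' rule: rtranclp_induct)
  case (step y)
  obtain p1 w1 l1 r1 where y: "y = (p1, w1, l1, r1)" by (cases y)
  have 1: "read_step M (p1, w1, l1, r1 @ [Top M]) (p, w', l', r' @ [Top M])"
    using step(2) y unfolding left_step_def by simp
  have IH: "l1 @ r1 = l @ r" "(read_step M)\<^sup>*\<^sup>* (q, w, l, r @ t) (p1, w1, l1, r1 @ t)"
    using step(3)[OF y] by auto
  have "l1 @ r1 @ t \<in> stack_words M" using IH(1) assms(2) by (metis append.assoc)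
  then have "read_step M (p1, w1, l1, r1 @ t) (p, w', l', r' @ t)" using left_transfer[OF 1] by blast
  then show ?case using read_step_word(1)[OF 1] IH by (auto intro: rtranclp.rtrancl_into_rtrancl)
qed simp

text \<open>The pair \<open>(q, j)\<close> stands for state \<open>q\<close> with remaining input \<open>drop j v\<close>, the head being on
  the last symbol of \<open>g\<close>.\<close>

definition crossings :: "'a list \<Rightarrow> 'a list \<Rightarrow> 'g list \<Rightarrow> 'g list \<Rightarrow> ('q \<times> nat) set" where
  "crossings u v g t = {(q, j). j \<le> length v \<and> (sa_step M)\<^sup>*\<^sup>* (initial M u) (q, drop j v, g, t) \<and>
     accepts_from M (q, drop j v, g, t)}"

text \<open>\<open>None\<close> records an excursion below the boundary that ends in acceptance.\<close>

definition excursions ::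
  "'a list \<Rightarrow> 'a list \<Rightarrow> 'g list \<Rightarrow> 'g list \<Rightarrow> (('q \<times> nat) \<times> ('q \<times> nat) option) set" where
  "excursions u v g t =
     {((q, j), Some (q', j')) | q j q' j'. (q, j) \<in> crossings u v g t \<and> (q', j') \<in> crossings u v g t \<and>
        left_step\<^sup>*\<^sup>* (q, drop j v, g, []) (q', drop j' v, g, [])} \<union>
     {((q, j), None) | q j. (q, j) \<in> crossings u v g t \<and>
        (\<exists>f l r. left_step\<^sup>*\<^sup>* (q, drop j v, g, []) (f, [], l, r) \<and> f \<in> Final M)}"

text \<open>The rest of an accepting reading phase on \<open>g' @ t\<close> is carried over to
  \<open>g @ t\<close> by induction from its end. With the head on or above the boundary the same
  moves work over \<open>g\<close>. An excursion below is not imitated step by step: the second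
  conjunct remembers its starting point \<open>(qd, jd)\<close> until it returns or accepts, when
  the common \<open>excursions\<close> provide a counterpart in \<open>g\<close>. This counterpart
  runs on \<open>g\<close> alone, so \<open>t0\<close> may differ from \<open>t\<close>.\<close>

lemma simulation:
  assumes g: "g @ [Top M] \<in> stack_words M" "g' @ [Top M] \<in> stack_words M" "last g = last g'"
    and t: "g @ t \<in> stack_words M"
    and ex: "excursions u v g t0 = excursions u' v g' t"
    and run: "(read_step M)\<^sup>*\<^sup>* (q, drop j v, lc, rc) (f, [], lf, rf)" and f: "f \<in> Final M"
    and reach: "(sa_step M)\<^sup>*\<^sup>* (initial M u') (q, drop j v, lc, rc)"
    and j: "j \<le> length v" and word: "lc @ rc = g' @ t"
  shows "(\<forall>l. lc = g' @ l \<longrightarrow> accepts_from M (q, drop j v, g @ l, rc)) \<and>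
    (\<forall>qd jd r1. (qd, jd) \<in> crossings u' v g' t \<longrightarrow>
       left_step\<^sup>*\<^sup>* (qd, drop jd v, g', []) (q, drop j v, lc, r1) \<longrightarrow> rc = r1 @ t \<longrightarrow>
       accepts_from M (qd, drop jd v, g, t))"
  using run reach j word
proof (induction "(q, drop j v, lc, rc)" arbitrary: q j lc rc rule: converse_rtranclp_induct)
  case base
  show ?case
  proof (intro conjI allI impI)
    fix l
    have "(sa_step M)\<^sup>*\<^sup>* (f, drop j v, g @ l, rf) (f, [], g @ l, rf)" using base by simp
    then show "accepts_from M (f, drop j v, g @ l, rf)" using f unfolding accepts_from_def by blast
  next
    fix qd jd r1
    assume d: "(qd, jd) \<in> crossings u' v g' t"
      and path: "left_step\<^sup>*\<^sup>* (qd, drop jd v, g', []) (f, drop j v, lf, r1)"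
    have "((qd, jd), None) \<in> excursions u' v g' t"
      using d path base f unfolding excursions_def by auto
    then have "((qd, jd), None) \<in> excursions u v g t0" using ex by simp
    then obtain f' l' r' where f': "left_step\<^sup>*\<^sup>* (qd, drop jd v, g, []) (f', [], l', r')" "f' \<in> Final M"
      unfolding excursions_def by auto
    have "(read_step M)\<^sup>*\<^sup>* (qd, drop jd v, g, [] @ t) (f', [], l', r' @ t)"
      using left_steps_embed[OF f'(1)] t by simp
    then show "accepts_from M (qd, drop jd v, g, t)"
      using read_steps_imp_sa_steps f'(2) unfolding accepts_from_def by fastforce
  qed
next
  case (step z)
  obtain q2 w2 l2 r2 where z0: "z = (q2, w2, l2, r2)" by (cases z)
  have st: "read_step M (q, drop j v, lc, rc) (q2, w2, l2, r2)" using step(1) z0 by simp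
  \<comment> \<open>A step leaves a suffix of \<open>v\<close>, which is brought back to the form
    \<open>drop j2 v\<close>.\<close>
  define j2 where "j2 = length v - length w2"
  obtain y where y: "drop j v = y @ w2" using read_step_consume[OF st] by (elim exE conjE)
  have "v = (take j v @ y) @ w2" using y by (metis append.assoc append_take_drop_id)
  then have w2: "w2 = drop j2 v" unfolding j2_def
    by (metis append_eq_conv_conj diff_add_inverse2 length_append)
  have j2: "j2 \<le> length v" unfolding j2_def by simp
  have z: "z = (q2, drop j2 v, l2, r2)" using z0 w2 by simp
  have word2: "l2 @ r2 = g' @ t" using read_step_word(1)[OF st] step(6) by simp
  have reach2: "(sa_step M)\<^sup>*\<^sup>* (initial M u') (q2, drop j2 v, l2, r2)"
    using step(4) read_step_imp_sa_step[OF step(1)] z by (auto intro: rtranclp.rtrancl_into_rtrancl)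
  have IH1: "accepts_from M (q2, drop j2 v, g @ l, r2)" if "l2 = g' @ l" for l
    using step(3)[OF z reach2 j2 word2] that by blast
  have IH2: "accepts_from M (qd, drop jd v, g, t)"
    if "(qd, jd) \<in> crossings u' v g' t" "left_step\<^sup>*\<^sup>* (qd, drop jd v, g', []) (q2, drop j2 v, l2, r1)" "r2 = r1 @ t"
    for qd jd r1
    using step(3)[OF z reach2 j2 word2] that by blast
  have co: "accepts_from M (q, drop j v, lc, rc)"
  proof -
    have "(read_step M)\<^sup>*\<^sup>* (q, drop j v, lc, rc) (f, [], lf, rf)"
      using step(1,2) by (rule converse_rtranclp_into_rtranclp)
    then show ?thesis using f read_steps_imp_sa_steps unfolding accepts_from_def by blast
  qed
  \<comment> \<open>The configuration is reachable and leads to acceptance, so every visit of the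
    boundary is a crossing.\<close>
  have cross: "(q, j) \<in> crossings u' v g' t" if "lc = g'" "rc = t"
    using step(4,5) co that unfolding crossings_def by simp
  have len: "length l2 \<le> Suc (length lc)" "length lc \<le> Suc (length l2)"
    using read_step_word(2,3)[OF st] .
  have ne: "g \<noteq> []" "g' \<noteq> []" using g(1,2) by (auto simp: word_iff)
  have left: "\<exists>r1. r2 = r1 @ t \<and> left_step (q, drop j v, lc, r) (q2, drop j2 v, l2, r1)"
    if "length l2 \<le> length g'" "rc = r @ t" for r
  proof -
    have "l2 = take (length l2) g'" "r2 = drop (length l2) g' @ t"
      using that(1) word2 by (simp_all add: append_eq_append_conv_if)
    then obtain r1 where r1: "g' = l2 @ r1" "r2 = r1 @ t"
      by (metis append_take_drop_id)
    have "lc @ r = g'" using step(6) that(2) by simp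
    then have "lc @ r @ [Top M] \<in> stack_words M" using g(2) by (metis append.assoc)
    then have "read_step M (q, drop j v, lc, r @ [Top M]) (q2, drop j2 v, l2, r1 @ [Top M])"
      using left_transfer[of q "drop j v" lc r t q2 "drop j2 v" l2 r1] st r1 that(2) w2 by simp
    then show ?thesis using r1 unfolding left_step_def by auto
  qed
  have first: "accepts_from M (q, drop j v, g @ l, rc)" if l: "lc = g' @ l" for l
  proof (cases "length g' \<le> length l2")
    case True
    then obtain l2' where l2': "l2 = g' @ l2'"
      using word2 by (auto simp: append_eq_append_conv2)
    have "(g @ l) @ rc \<in> stack_words M" using t step(6) l by simp
    then have "read_step M (q, drop j v, g @ l, rc) (q2, w2, g @ l2', r2)"
      using right_transfer[of q "drop j v" g' l rc q2 w2 l2' r2 g] st l l2' ne g(3) by simp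
    then show ?thesis using IH1[OF l2'] w2 accepts_from_steps
      by (metis read_step_imp_sa_step r_into_rtranclp)
  next
    case False
    \<comment> \<open>The head moves by at most one position, so a step that ends below the boundary
      starts on it: an excursion begins.\<close>
    moreover have "length g' + length l \<le> Suc (length l2)" using l len by simp
    ultimately have "length l = 0" by linarith
    then have "l = []" by simp
    then have lc: "lc = g'" "rc = t" using l step(6) by auto
    obtain r1 where r1: "r2 = r1 @ t" "left_step (q, drop j v, lc, []) (q2, drop j2 v, l2, r1)"
      using left[of "[]"] lc(2) False by auto
    show ?thesis using IH2[OF cross[OF lc], of r1] r1 lc \<open>l = []\<close> by auto
  qed
  show ?case
  proof (intro conjI allI impI)
    fix l assume "lc = g' @ l"
    then show "accepts_from M (q, drop j v, g @ l, rc)" by (rule first)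
  next
    fix qd jd r
    assume d: "(qd, jd) \<in> crossings u' v g' t" and rc: "rc = r @ t"
      and path: "left_step\<^sup>*\<^sup>* (qd, drop jd v, g', []) (q, drop j v, lc, r)"
    show "accepts_from M (qd, drop jd v, g, t)"
    proof (cases "length l2 \<le> length g'")
      case True
      then obtain r1 where r1: "r2 = r1 @ t" "left_step (q, drop j v, lc, r) (q2, drop j2 v, l2, r1)"
        using left rc by blast
      then show ?thesis using IH2[OF d _ r1(1)] path by (meson rtranclp.rtrancl_into_rtrancl)
    next
      case False
      \<comment> \<open>The step goes above the boundary, so the head was on it before: the
        excursion is over at \<open>(q, j)\<close>, and \<open>first\<close> continues from
        there.\<close>
      have lr: "lc @ r = g'" using step(6) rc by simp
      moreover have "length lc \<ge> length g'" using False len by simp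
      ultimately have lc: "r = []" "lc = g'" by auto
      have "((qd, jd), Some (q, j)) \<in> excursions u' v g' t"
        using d cross lc rc path unfolding excursions_def by simp
      then have "((qd, jd), Some (q, j)) \<in> excursions u v g t0" using ex by simp
      then have "left_step\<^sup>*\<^sup>* (qd, drop jd v, g, []) (q, drop j v, g, [])"
        unfolding excursions_def by auto
      then have "(read_step M)\<^sup>*\<^sup>* (qd, drop jd v, g, [] @ t) (q, drop j v, g, [] @ t)"
        using left_steps_embed[of qd "drop jd v" g "[]" q "drop j v" g "[]" t] t by simp
      then show ?thesis using first[of "[]"] lc rc accepts_from_steps read_steps_imp_sa_steps
        by fastforce
    qed
  qed
qed

end

section \<open>Counting estimates\<close>

text \<open>A subset with at most \<open>k\<close> elements is the set of a list of length at most
  \<open>k\<close>. The summand 1 in the base makes its powers increase with the exponent even if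
  \<open>X\<close> is empty.\<close>

lemma card_bounded_subsets:
  assumes "finite X"
  shows "finite {E. E \<subseteq> X \<and> card E \<le> k}"
    and "card {E. E \<subseteq> X \<and> card E \<le> k} \<le> (k + 1) * (card X + 1) ^ k"
proof -
  let ?L = "{xs. set xs \<subseteq> X \<and> length xs \<le> k}"
  have "{E. E \<subseteq> X \<and> card E \<le> k} \<subseteq> set ` ?L"
  proof
    fix E assume E: "E \<in> {E. E \<subseteq> X \<and> card E \<le> k}"
    then obtain xs where "set xs = E" "length xs = card E"
      using assms by (metis finite_distinct_list distinct_card finite_subset mem_Collect_eq)
    then show "E \<in> set ` ?L" using E by (intro image_eqI[of _ _ xs]) auto
  qed
  moreover have fin: "finite ?L" using finite_lists_length_le[OF assms] .
  ultimately have "card {E. E \<subseteq> X \<and> card E \<le> k} \<le> card ?L"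
    by (meson card_image_le card_mono finite_imageI le_trans)
  also have "\<dots> = (\<Sum>i\<le>k. card X ^ i)" using card_lists_length_le[OF assms] .
  also have "\<dots> \<le> (\<Sum>i\<le>k. (card X + 1) ^ k)"
  proof (rule sum_mono)
    fix i assume "i \<in> {..k}"
    then have "card X ^ i \<le> (card X + 1) ^ i" "(card X + 1) ^ i \<le> (card X + 1) ^ k"
      by (auto intro: power_mono power_increasing)
    then show "card X ^ i \<le> (card X + 1) ^ k" by simp
  qed
  also have "\<dots> = (k + 1) * (card X + 1) ^ k" by simp
  finally show "card {E. E \<subseteq> X \<and> card E \<le> k} \<le> (k + 1) * (card X + 1) ^ k" .
  show "finite {E. E \<subseteq> X \<and> card E \<le> k}" using assms by simp
qed

lemma polynomial_less_exponential: "\<exists>m. A * (B * (m + 1)) ^ k < (2::nat) ^ m"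
proof -
  \<comment> \<open>The choice of \<open>m\<close> turns \<open>m + 1\<close> into a power of two,
    which reduces the claim to exponents; \<open>s\<close> is large enough that \<open>s * s\<close>
    bounds \<open>A + B * k + 2 * s * k\<close>, while \<open>s * s < m\<close>.\<close>
  define s where "s = A + B * k + 3 * k + 2"
  define m where "m = 4 ^ s - (1::nat)"
  have sq: "Suc (s * s) < 2 ^ s * 2 ^ s"
  proof -
    have "Suc s \<le> 2 ^ s" by (simp add: Suc_leI)
    then have "Suc s * Suc s \<le> 2 ^ s * 2 ^ s" by (rule mult_le_mono) fact
    moreover have "Suc (s * s) < Suc s * Suc s" unfolding s_def by simp
    ultimately show ?thesis by linarith
  qed
  have four: "(4::nat) ^ s = 2 ^ s * 2 ^ s" by (simp flip: power_mult_distrib)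
  have m1: "m + 1 = 4 ^ s" unfolding m_def by simp
  have "A * (B * (m + 1)) ^ k \<le> 2 ^ A * (2 ^ B * 2 ^ (2 * s)) ^ k"
    unfolding m1 by (intro mult_le_mono power_mono) (auto simp: power_mult less_imp_le)
  also have "\<dots> = 2 ^ (A + B * k + 2 * s * k)"
    by (simp add: power_add power_mult power_mult_distrib)
  also have "\<dots> < 2 ^ m"
  proof (rule power_strict_increasing)
    have "A + B * k + 2 * s * k \<le> s * s"
    proof -
      have "s * s = A * s + B * k * s + 3 * k * s + 2 * s" unfolding s_def by (simp add: algebra_simps)
      moreover have "s \<ge> 1" unfolding s_def by simp
      ultimately show ?thesis by (simp add: add_mono trans_le_add1)
    qed
    then show "A + B * k + 2 * s * k < m" using sq four m1 by linarith
  qed simp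
  finally show ?thesis by blast
qed

section \<open>Crossings for an automaton that accepts the copy language\<close>

locale csa_copy = csa M Qw Qr for M :: "('q, 'a, 'g) sa" and Qw Qr +
  fixes a b dollar hash :: 'a
  assumes distinct: "distinct [a, b, dollar, hash]"
    and language: "accepted_language M = copy_language a b dollar hash"
    and limited: "\<not> s_unlimited M"
begin

abbreviation block :: "nat \<Rightarrow> 'a list" where
  "block n \<equiv> replicate n a @ [dollar] @ replicate n a"

abbreviation input :: "'a list \<Rightarrow> 'a list \<Rightarrow> nat \<Rightarrow> 'a list" where
  "input u v n \<equiv> u @ [dollar] @ v @ [hash] @ block n"

lemma input_in_language:
  assumes "u \<in> lists {a, b}"
  shows "input u u n \<in> accepted_language M"
proof -
  have "replicate n a \<in> lists {a, b}" by (auto simp: in_lists_conv_set)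
  then show ?thesis unfolding language copy_language_def using assms by auto
qed

lemma input_letters:
  assumes "u \<in> lists {a, b}"
  shows "input u u n \<in> lists (Input M)"
  using input_in_language[OF assms] unfolding accepted_language_iff by blast

text \<open>A Myhill-Nerode argument: two such configurations allow the input to be pumped within one of
  the two halves of \<open>block n\<close>.\<close>

lemma crossing_unique:
  assumes u: "u \<in> lists {a, b}"
    and i: "i \<le> 2 * n + 1" "(sa_step M)\<^sup>*\<^sup>* (initial M (input u u n)) (q, drop i (block n), l, r)"
    and j: "j \<le> 2 * n + 1" "accepts_from M (q, drop j (block n), l, r)"
    and half: "i \<le> n \<longleftrightarrow> j \<le> n"
  shows "i = j"
proof -
  let ?x = "u @ [dollar] @ u @ [hash] @ take i (block n)"
  have word: "?x @ drop i (block n) = input u u n" by (metis append.assoc append_take_drop_id)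
  have "?x \<in> lists (Input M)" "drop j (block n) \<in> lists (Input M)"
    using input_letters[OF u, of n] by (auto dest: in_set_takeD in_set_dropD simp del: drop_append take_append)
  then have L: "?x @ drop j (block n) \<in> copy_language a b dollar hash"
    using swap_input[of ?x "drop i (block n)" q l r "drop j (block n)"] i(2) j(2) word language by simp
  have ab: "replicate k a \<in> lists {a, b}" for k by (auto simp: in_lists_conv_set)
  show ?thesis
  proof (cases "i \<le> n")
    case True
    \<comment> \<open>Only the first half changes: it gets \<open>i + (n - j)\<close> letters, the
      second keeps its \<open>n\<close>.\<close>
    then have "?x @ drop j (block n) =
        u @ [dollar] @ u @ [hash] @ replicate (i + (n - j)) a @ [dollar] @ replicate n a"
      unfolding replicate_add using half True by (simp add: min_def)
    then have "replicate (i + (n - j)) a = replicate n a"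
      using copy_language_decode(2)[OF distinct u u ab ab] L by metis
    then have "i + (n - j) = n" by (metis length_replicate)
    then show ?thesis using True half by simp
  next
    case False
    \<comment> \<open>Past the separator only the second half changes. The 1 in
      \<open>i - n - 1\<close> is the \<open>dollar\<close> inside
      \<open>take i (block n)\<close>.\<close>
    then have "?x @ drop j (block n) =
        u @ [dollar] @ u @ [hash] @ replicate n a @ [dollar] @ replicate ((i - n - 1) + (2 * n + 1 - j)) a"
    proof -
      have "i - Suc n \<le> n" using i(1) by simp
      then show ?thesis unfolding replicate_add
        using half False i(1) j(1) by (simp add: min_def drop_Cons' take_Cons' mult_2)
    qed
    then have "replicate n a = replicate ((i - n - 1) + (2 * n + 1 - j)) a"
      using copy_language_decode(2)[OF distinct u u ab ab] L by metis
    then have "n = (i - n - 1) + (2 * n + 1 - j)" by (metis length_replicate)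
    then show ?thesis using False half i(1) j(1) by simp
  qed
qed

lemma suffix_of_shorter:
  assumes "x @ y = x' @ y'" "length y \<le> length y'"
  shows "\<exists>z. y' = z @ y"
  using assms by (auto simp: append_eq_append_conv2)

text \<open>Otherwise writing would end before \<open>block n\<close> is begun, with a stack bounded
  in terms of \<open>length u\<close>. All suffixes \<open>drop i (block n)\<close> with
  \<open>i \<le> n\<close> would then be met over this stack, where at most \<open>n\<close> pairs
  of state and head position are available, against \<open>crossing_unique\<close>.\<close>

lemma hash_written:
  assumes u: "u \<in> lists {a, b}"
    and writes: "(write_step M)\<^sup>*\<^sup>* (initial M (input u u n)) (p, w, l, [Top M])"
    and read: "(read_step M)\<^sup>*\<^sup>* (p, w, l, [Top M]) (f, [], lf, rf)" "f \<in> Final M"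
    and n: "card (States M) * (card (States M) * card (Stack M) * (2 * length u + 3) + 2) \<le> n"
  shows "length w < 2 * n + 1"
proof (rule ccontr)
  assume "\<not> ?thesis"
  then have long: "2 * n + 1 \<le> length w" by simp
  have "length l \<le> card (States M) * card (Stack M) * (length (input u u n) - length w + 1)"
    using write_bound[OF limited input_letters[OF u] writes] .
  \<comment> \<open>The input has \<open>2 * length u + 2 * n + 3\<close> letters, of which at least
    \<open>2 * n + 1\<close> are unread.\<close>
  also have "\<dots> \<le> card (States M) * card (Stack M) * (2 * length u + 3)"
    using long by (intro mult_le_mono2) simp
  finally have l: "length l \<le> card (States M) * card (Stack M) * (2 * length u + 3)" .
  obtain x0 where x0: "input u u n = x0 @ w"
    using sa_steps_suffix[OF write_steps_imp_sa_steps[OF writes]] by (elim exE)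
  have mid: "\<exists>qi li ri. (sa_step M)\<^sup>*\<^sup>* (initial M (input u u n)) (qi, drop i (block n), li, ri) \<and>
      accepts_from M (qi, drop i (block n), li, ri) \<and> li @ ri = l @ [Top M]" for i
  proof -
    have "\<exists>x. w = x @ drop i (block n)"
    proof -
      have "(u @ [dollar] @ u @ [hash]) @ block n = x0 @ w" using x0 by simp
      moreover have "length (block n) \<le> length w" using long by simp
      ultimately obtain y where "w = y @ block n" using suffix_of_shorter by blast
      then have "w = (y @ take i (block n)) @ drop i (block n)"
        by (metis append.assoc append_take_drop_id)
      then show ?thesis by (rule exI)
    qed
    then obtain x where x: "w = x @ drop i (block n)" by (elim exE)
    obtain qi li ri where
      1: "(read_step M)\<^sup>*\<^sup>* (p, w, l, [Top M]) (qi, drop i (block n), li, ri)" and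
      2: "(read_step M)\<^sup>*\<^sup>* (qi, drop i (block n), li, ri) (f, [], lf, rf)"
      using read_steps_intermediate_input[OF read(1)[unfolded x]] x by auto
    have "accepts_from M (qi, drop i (block n), li, ri)"
      using read_steps_imp_sa_steps[OF 2] read(2) unfolding accepts_from_def by blast
    then show ?thesis
      using rtranclp_trans[OF write_steps_imp_sa_steps[OF writes] read_steps_imp_sa_steps[OF 1]]
        read_steps_word[OF 1] by blast
  qed
  obtain qi li ri where m:
      "\<And>i. (sa_step M)\<^sup>*\<^sup>* (initial M (input u u n)) (qi i, drop i (block n), li i, ri i)"
      "\<And>i. accepts_from M (qi i, drop i (block n), li i, ri i)"
      "\<And>i. li i @ ri i = l @ [Top M]"
    using mid by metis
  define h where "h i = (qi i, length (li i))" for i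
  \<comment> \<open>Head positions are counted from 0 to \<open>length l + 1\<close>, the latter
    being on \<open>Top M\<close>; hence the summand 2 in the assumption on
    \<open>n\<close>.\<close>
  let ?B = "States M \<times> {..length l + 1}"
  have "h ` {..n} \<subseteq> ?B"
  proof (rule image_subsetI)
    fix i
    have "Start M \<in> States M" using automaton unfolding stack_automaton_def by blast
    then have "qi i \<in> States M" using sa_steps_states[OF m(1)] by blast
    moreover have "length (li i) \<le> length l + 1" using arg_cong[OF m(3)[of i], of length] by simp
    ultimately show "h i \<in> ?B" unfolding h_def by simp
  qed
  moreover have "finite ?B" using automaton unfolding stack_automaton_def by blast
  moreover have "card ?B < card {..n}"
  proof -
    have "card (States M) * (length l + 2) \<le> n"
      using mult_le_mono2[of "length l + 2" _ "card (States M)"] l n by (meson add_le_mono1 le_trans)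
    then show ?thesis by (simp add: card_cartesian_product)
  qed
  ultimately have "\<not> inj_on h {..n}" by (meson card_inj_on_le leD)
  then obtain i j where ij: "i \<le> n" "j \<le> n" "h i = h j" "i \<noteq> j" unfolding inj_on_def by auto
  then have "qi i = qi j" and len: "length (li i) = length (li j)" unfolding h_def by simp_all
  moreover have "li i = li j" "ri i = ri j"
    using m(3)[of i] m(3)[of j] len by (metis append_eq_append_conv)+
  ultimately have "qi i = qi j" "li i = li j" "ri i = ri j" by simp_all
  then show False using crossing_unique[OF u _ m(1)[of i], of j] m(2)[of j] ij by simp
qed

section \<open>Profiles of words\<close>

text \<open>A fingerprint of the stack \<open>g\<close> present when \<open>u\<close> and
  \<open>dollar\<close> have been read, in some accepting run that writes until after
  \<open>hash\<close>; it records what the rest of the run can notice of \<open>g\<close>. It is a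
  relation because runs are not unique.\<close>

definition profile :: "'a list \<Rightarrow> nat \<Rightarrow> 'q \<times> 'g \<times> (('q \<times> nat) \<times> ('q \<times> nat) option) set \<Rightarrow> bool" where
  "profile u n d \<longleftrightarrow> (\<exists>q g p j h f lf rf.
     (write_step M)\<^sup>*\<^sup>* (initial M (input u u n)) (q, u @ [hash] @ block n, g, [Top M]) \<and>
     (write_step M)\<^sup>*\<^sup>* (q, u @ [hash] @ block n, g, [Top M]) (p, drop j (block n), g @ h, [Top M]) \<and>
     j \<le> length (block n) \<and>
     (read_step M)\<^sup>*\<^sup>* (p, drop j (block n), g @ h, [Top M]) (f, [], lf, rf) \<and> f \<in> Final M \<and>
     d = (q, last g, excursions (input u u n) (block n) g (h @ [Top M])))"

text \<open>The universe of entries grows with \<open>n\<close>, but the size of each set is bounded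
  independently of \<open>n\<close>; this keeps the number of profiles polynomial.\<close>

definition profiles :: "nat \<Rightarrow> ('q \<times> 'g \<times> (('q \<times> nat) \<times> ('q \<times> nat) option) set) set" where
  "profiles n = (let P = States M \<times> {..2 * n + 1}; s = card (States M) in
     States M \<times> Stack M \<times> {E. E \<subseteq> P \<times> insert None (Some ` P) \<and> card E \<le> 2 * s * (2 * s + 1)})"

text \<open>By \<open>crossing_unique\<close>, the state and the half of \<open>block n\<close>
  determine the remaining input.\<close>

lemma crossings_bound:
  assumes u: "u \<in> lists {a, b}"
  shows "crossings (input u u n) (block n) g t \<subseteq> States M \<times> {..2 * n + 1}"
    and "card (crossings (input u u n) (block n) g t) \<le> 2 * card (States M)"
proof -
  let ?D = "crossings (input u u n) (block n) g t"
  have D: "j \<le> 2 * n + 1 \<and> (sa_step M)\<^sup>*\<^sup>* (initial M (input u u n)) (q, drop j (block n), g, t) \<and>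
     accepts_from M (q, drop j (block n), g, t)" if "(q, j) \<in> ?D" for q j
    using that unfolding crossings_def by simp
  have "Start M \<in> States M" and fin: "finite (States M)"
    using automaton unfolding stack_automaton_def by blast+
  then show sub: "?D \<subseteq> States M \<times> {..2 * n + 1}"
    using D sa_steps_states by fastforce
  define h where "h = (\<lambda>(q :: 'q, j). (q, j \<le> n))"
  have "inj_on h ?D"
  proof (rule inj_onI, clarify)
    fix q i q' j
    assume a: "(q, i) \<in> ?D" "(q', j) \<in> ?D" "h (q, i) = h (q', j)"
    then have q: "q' = q" "i \<le> n \<longleftrightarrow> j \<le> n" unfolding h_def by auto
    have "i = j" using crossing_unique[OF u _ _ _ _ q(2)] D[OF a(1)] D[OF a(2)] unfolding q(1) by blast
    then show "q = q' \<and> i = j" using q(1) by simp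
  qed
  moreover have "h ` ?D \<subseteq> States M \<times> (UNIV :: bool set)" using sub unfolding h_def by auto
  ultimately have "card ?D \<le> card (States M \<times> (UNIV :: bool set))"
    using fin by (intro card_inj_on_le[of h]) auto
  then show "card ?D \<le> 2 * card (States M)" by (simp add: card_cartesian_product)
qed

text \<open>The summand 1 accounts for \<open>None\<close> as a second component.\<close>

lemma excursions_bound:
  assumes u: "u \<in> lists {a, b}"
  shows "excursions (input u u n) (block n) g t \<subseteq>
      (States M \<times> {..2 * n + 1}) \<times> insert None (Some ` (States M \<times> {..2 * n + 1}))"
    and "card (excursions (input u u n) (block n) g t) \<le> 2 * card (States M) * (2 * card (States M) + 1)"
proof -
  let ?D = "crossings (input u u n) (block n) g t"
  have sub: "excursions (input u u n) (block n) g t \<subseteq> ?D \<times> insert None (Some ` ?D)"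
    unfolding excursions_def by auto
  then show "excursions (input u u n) (block n) g t \<subseteq>
      (States M \<times> {..2 * n + 1}) \<times> insert None (Some ` (States M \<times> {..2 * n + 1}))"
    by (rule order_trans) (intro Sigma_mono insert_mono image_mono crossings_bound(1)[OF u])
  have fin: "finite ?D"
    using automaton unfolding stack_automaton_def
    by (intro finite_subset[OF crossings_bound(1)[OF u]] finite_cartesian_product) auto
  then have "card (excursions (input u u n) (block n) g t) \<le> card (?D \<times> insert None (Some ` ?D))"
    using sub by (intro card_mono) auto
  also have "\<dots> = card ?D * (card ?D + 1)"
    using fin by (simp add: card_cartesian_product card_insert_if card_image)
  also have "\<dots> \<le> 2 * card (States M) * (2 * card (States M) + 1)"
    using crossings_bound(2)[OF u] by (intro mult_le_mono) auto
  finally show "card (excursions (input u u n) (block n) g t) \<le> \<dots>" .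
qed

text \<open>By \<open>hash_written\<close>, the writing phase of an accepting run lasts beyond the
  first \<open>dollar\<close>, so it can be cut there.\<close>

lemma profile_exists:
  assumes u: "u \<in> lists {a, b}"
    and n: "card (States M) * (card (States M) * card (Stack M) * (2 * length u + 3) + 2) \<le> n"
  shows "\<exists>d \<in> profiles n. profile u n d"
proof -
  obtain f lf rf where f: "f \<in> Final M" "(sa_step M)\<^sup>*\<^sup>* (initial M (input u u n)) (f, [], lf, rf)"
    using input_in_language[OF u] unfolding accepted_language_iff accepts_from_def by blast
  obtain p w l r where w: "(write_step M)\<^sup>*\<^sup>* (initial M (input u u n)) (p, w, l, r)"
    and read: "(read_step M)\<^sup>*\<^sup>* (p, w, l, r) (f, [], lf, rf)"
    using write_read_decomposition[OF f(2)] by (metis prod_cases4)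
  have r: "r = [Top M]" using write_steps_replay[OF w initial_word] by (elim conjE)
  have short: "length w < 2 * n + 1" using hash_written[OF u _ _ f(1) n] w read r by blast
  obtain x where "input u u n = x @ w"
    using sa_steps_suffix[OF write_steps_imp_sa_steps[OF w]] by (elim exE)
  then have "x @ w = (u @ [dollar] @ u @ [hash]) @ block n" by simp
  moreover have "length w \<le> length (block n)" using short by simp
  ultimately obtain y where "block n = y @ w" using suffix_of_shorter by blast
  then obtain j where j: "w = drop j (block n)" "j \<le> length (block n)"
    by (metis append_eq_conv_conj le_add1 length_append)
  have "input u u n = (u @ [dollar]) @ (u @ [hash] @ block n)" by simp
  then have w': "(write_step M)\<^sup>*\<^sup>* (Start M, (u @ [dollar]) @ (u @ [hash] @ block n), [Bottom M], [Top M]) (p, w, l, r)"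
    using w by simp
  obtain q g r1 where q: "(write_step M)\<^sup>*\<^sup>* (initial M (input u u n)) (q, u @ [hash] @ block n, g, r1)"
    "(write_step M)\<^sup>*\<^sup>* (q, u @ [hash] @ block n, g, r1) (p, w, l, r)"
    using write_steps_intermediate_input[OF w'] short by auto
  have r1: "r1 = [Top M]" using write_steps_replay[OF q(1) initial_word] by (elim conjE)
  have g: "g @ [Top M] \<in> stack_words M" using write_steps_word[OF _ initial_word] q(1) r1 by blast
  obtain h where h: "l = g @ h"
    using write_steps_replay[OF q(2)[unfolded r1] g] by (elim conjE exE)
  let ?d = "(q, last g, excursions (input u u n) (block n) g (h @ [Top M]))"
  have "profile u n ?d"
    unfolding profile_def using q read f(1) j h r r1 by blast
  moreover have "?d \<in> profiles n"
  proof -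
    have "Start M \<in> States M" using automaton unfolding stack_automaton_def by blast
    then have "q \<in> States M" using sa_steps_states[OF write_steps_imp_sa_steps[OF q(1)]] by blast
    then show ?thesis
      unfolding profiles_def Let_def using last_in_Stack[OF g] excursions_bound[OF u] by blast
  qed
  ultimately show ?thesis by blast
qed

text \<open>Cut and paste: the run for \<open>u\<close> is followed while it writes
  \<open>g\<close>, then the run for \<open>u'\<close> supplies the rest, its upper stack being
  written above \<open>g\<close> and its reading phase adapted by \<open>simulation\<close>. The
  word so accepted combines \<open>u\<close> with \<open>u'\<close>, which the copy language allows
  only if they are equal.\<close>

lemma profile_injective:
  assumes u: "u \<in> lists {a, b}" "u' \<in> lists {a, b}" and d: "profile u n d" "profile u' n d"
  shows "u = u'"
proof -
  obtain q x E where d0: "d = (q, x, E)" by (cases d)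
  obtain g h where
    1: "(write_step M)\<^sup>*\<^sup>* (initial M (input u u n)) (q, u @ [hash] @ block n, g, [Top M])" and
    x: "x = last g" and E: "E = excursions (input u u n) (block n) g (h @ [Top M])"
    using d(1) unfolding profile_def d0 by auto
  obtain g' p j h' f lf rf where
    run1: "(write_step M)\<^sup>*\<^sup>* (initial M (input u' u' n)) (q, u' @ [hash] @ block n, g', [Top M])" and
    run2: "(write_step M)\<^sup>*\<^sup>* (q, u' @ [hash] @ block n, g', [Top M]) (p, drop j (block n), g' @ h', [Top M])" and
    j: "j \<le> length (block n)" and
    run3: "(read_step M)\<^sup>*\<^sup>* (p, drop j (block n), g' @ h', [Top M]) (f, [], lf, rf)" and f: "f \<in> Final M" and
    x': "x = last g'" and E': "E = excursions (input u' u' n) (block n) g' (h' @ [Top M])"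
    using d(2) unfolding profile_def d0 by auto
  have g: "g @ [Top M] \<in> stack_words M" and g': "g' @ [Top M] \<in> stack_words M"
    using write_steps_word[OF 1 initial_word] write_steps_word[OF run1 initial_word] by simp_all
  have letters: "u @ [dollar] \<in> lists (Input M)" "u' @ [hash] @ block n \<in> lists (Input M)"
    using input_letters[OF u(1), of n] input_letters[OF u(2), of n] by auto
  have first: "(sa_step M)\<^sup>*\<^sup>* (initial M (input u u' n)) (q, u' @ [hash] @ block n, g, [Top M])"
  proof -
    obtain z where z: "input u u n = z @ u @ [hash] @ block n"
      "\<forall>w0 \<in> lists (Input M). z \<in> lists (Input M) \<longrightarrow>
        (sa_step M)\<^sup>*\<^sup>* (initial M (z @ w0)) (q, w0, g, [Top M])"
      using sa_steps_consume[OF write_steps_imp_sa_steps[OF 1]] by (elim exE conjE)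
    have "z = u @ [dollar]" using z(1) by simp
    then show ?thesis using z(2) letters by auto
  qed
  obtain s z where s: "s \<in> lists (Stack0 M)" "g' @ h' = g' @ s" "u' @ [hash] @ block n = z @ drop j (block n)"
    "\<forall>w0 \<in> lists (Input M). z \<in> lists (Input M) \<longrightarrow>
      (\<forall>l0. l0 @ [Top M] \<in> stack_words M \<longrightarrow> last l0 = last g' \<longrightarrow>
       (write_step M)\<^sup>*\<^sup>* (q, z @ w0, l0, [Top M]) (p, w0, l0 @ s, [Top M]))"
    using write_steps_replay[OF run2 g'] by (elim exE conjE)
  have "z \<in> lists (Input M)" "drop j (block n) \<in> lists (Input M)"
    using letters(2) unfolding s(3) by simp_all
  then have "(write_step M)\<^sup>*\<^sup>* (q, z @ drop j (block n), g, [Top M]) (p, drop j (block n), g @ s, [Top M])"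
    using s(4) g x x' by simp
  then have second: "(sa_step M)\<^sup>*\<^sup>* (q, u' @ [hash] @ block n, g, [Top M]) (p, drop j (block n), g @ h', [Top M])"
    using write_steps_imp_sa_steps s(2,3) by simp
  have "accepts_from M (p, drop j (block n), g @ h', [Top M])"
  proof -
    have word: "g @ h' @ [Top M] \<in> stack_words M" using word_append[OF g s(1)] s(2) by simp
    have reach: "(sa_step M)\<^sup>*\<^sup>* (initial M (input u' u' n)) (p, drop j (block n), g' @ h', [Top M])"
      using write_steps_imp_sa_steps[OF rtranclp_trans[OF run1 run2]] .
    have "last g = last g'" using x x' by simp
    \<comment> \<open>Here \<open>t0\<close> is the upper part \<open>h @ [Top M]\<close> from the
      run for \<open>u\<close>, and \<open>t\<close> is \<open>h' @ [Top M]\<close> from the run for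
      \<open>u'\<close>.\<close>
    note sim = simulation[OF g g' this word E[symmetric, unfolded E'] run3 f reach j]
    show ?thesis using conjunct1[OF sim] by simp
  qed
  then have "accepts_from M (initial M (input u u' n))"
    using accepts_from_steps first second by blast
  moreover have "input u u' n \<in> lists (Input M)" using letters by simp
  ultimately have "input u u' n \<in> copy_language a b dollar hash"
    using language accepted_language_iff by blast
  moreover have "replicate n a \<in> lists {a, b}" by (auto simp: in_lists_conv_set)
  ultimately show ?thesis using copy_language_decode(1)[OF distinct u] by metis
qed

section \<open>Pigeonhole on the profiles\<close>

lemma contradiction: False
proof -
  define s where "s = card (States M)"
  define y where "y = card (Stack M)"
  define K where "K = 2 * s * (2 * s + 1)"
  \<comment> \<open>Since \<open>2 * m + 3 \<le> 3 * (m + 1)\<close>, this \<open>C\<close> yields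
    \<open>s * (2 * n + 2) + 1 \<le> C * (m + 1)\<close> for the \<open>n\<close> below.\<close>
  define C where "C = s * (2 * (s * (s * y * 3 + 2)) + 2) + 1"
  obtain m where m: "s * y * (K + 1) * (C * (m + 1)) ^ (2 * K) < 2 ^ m"
    using polynomial_less_exponential by blast
  \<comment> \<open>The least \<open>n\<close> that \<open>profile_exists\<close> admits for words
    of length \<open>m\<close>; it is linear in \<open>m\<close>.\<close>
  define n where "n = s * (s * y * (2 * m + 3) + 2)"
  define U where "U = {u. set u \<subseteq> {a, b} \<and> length u = m}"
  have U: "u \<in> lists {a, b}" "length u = m" if "u \<in> U" for u
    using that unfolding U_def by auto
  have "card U = 2 ^ m"
    using distinct card_lists_length_eq[of "{a, b}" m] unfolding U_def by (simp add: numeral_2_eq_2)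
  have "\<forall>u \<in> U. \<exists>d. d \<in> profiles n \<and> profile u n d"
    using profile_exists U unfolding n_def s_def y_def by (metis le_refl)
  then obtain F where F: "\<And>u. u \<in> U \<Longrightarrow> F u \<in> profiles n \<and> profile u n (F u)" by metis
  have "inj_on F U" using profile_injective F U(1) unfolding inj_on_def by metis
  let ?P = "States M \<times> {..2 * n + 1}"
  let ?X = "?P \<times> insert None (Some ` ?P)"
  have fin: "finite (States M)" "finite (Stack M)" "finite ?X"
    using automaton unfolding stack_automaton_def by auto
  have X: "card ?X = s * (2 * n + 2) * (s * (2 * n + 2) + 1)"
    using fin(1) unfolding s_def by (simp add: card_cartesian_product card_insert_if card_image)
  have prof: "profiles n = States M \<times> Stack M \<times> {E. E \<subseteq> ?X \<and> card E \<le> K}"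
    unfolding profiles_def Let_def K_def s_def ..
  \<comment> \<open>The bound on \<open>card ?X\<close> is quadratic in \<open>m\<close>, whence the
    exponent \<open>2 * K\<close> in the choice of \<open>m\<close>.\<close>
  have pow: "(card ?X + 1) ^ K \<le> ((C * (m + 1)) ^ 2) ^ K"
  proof (rule power_mono)
    have "s * (2 * n + 2) + 1 \<le> C * (m + 1)"
      unfolding n_def C_def by (simp add: algebra_simps)
    then have "(s * (2 * n + 2) + 1) * (s * (2 * n + 2) + 1) \<le> (C * (m + 1)) ^ 2"
      unfolding power2_eq_square by (intro mult_le_mono)
    then show "card ?X + 1 \<le> (C * (m + 1)) ^ 2" unfolding X by (simp add: algebra_simps)
  qed simp
  have "finite (profiles n)" unfolding prof using fin card_bounded_subsets(1)[OF fin(3)] by blast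
  then have "2 ^ m \<le> card (profiles n)"
    using card_inj_on_le[OF \<open>inj_on F U\<close>] F \<open>card U = 2 ^ m\<close> by (metis image_subsetI)
  also have "\<dots> = s * (y * card {E. E \<subseteq> ?X \<and> card E \<le> K})"
    unfolding prof s_def y_def using card_cartesian_product by metis
  also have "\<dots> \<le> s * (y * ((K + 1) * (card ?X + 1) ^ K))"
    by (intro mult_le_mono2 card_bounded_subsets(2)[OF fin(3)])
  also have "\<dots> \<le> s * (y * ((K + 1) * ((C * (m + 1)) ^ 2) ^ K))"
    by (intro mult_le_mono2 pow)
  also have "\<dots> = s * y * (K + 1) * (C * (m + 1)) ^ (2 * K)"
    by (simp only: power_mult mult.assoc)
  finally have "2 ^ m \<le> s * y * (K + 1) * (C * (m + 1)) ^ (2 * K)" .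
  then show False using m by simp
qed

end

theorem proposition14:
  fixes M :: "('q, 'a, 'g) sa" and a b dollar hash :: 'a
  assumes "distinct [a, b, dollar, hash]"
    and "checking_stack_automaton M"
    and "accepted_language M = copy_language a b dollar hash"
  shows "s_unlimited M"
proof (rule ccontr)
  assume limited: "\<not> s_unlimited M"
  obtain Qw Qr where "partitioned_by M Qw Qr"
    "\<And>q a y p i. \<lbrakk>sa_trans M q a y p i; q \<in> Qr\<rbrakk> \<Longrightarrow> p \<notin> Qw"
    using assms(2) unfolding checking_stack_automaton_def by metis
  then interpret csa_copy M Qw Qr a b dollar hash
    using assms limited unfolding checking_stack_automaton_def by unfold_locales auto
  show False by (rule contradiction)
qed

end
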